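(* Let $m$ and $c\ge 3$ be integers with $m\ge 3c-4$, and let $\mathcal{H}(m,c)$ be the set of simple graphs without isolated vertices that have exactly $m$ edges and circumference $c$. Let $H_{m,c}$ be the graph obtained from a cycle $C_c$ by choosing a vertex $v$ of the cycle, joining $v$ to each of the $c-3$ vertices of $C_c$ not already adjacent to it, and joining $v$ to each of $m-2c+3$ new vertices (pendent edges). Then $q(H)\le q(H_{m,c})$ for every $H\in\mathcal{H}(m,c)$, with equality if and only if $H\cong H_{m,c}$.
   Context: All graphs are finite, simple, undirected and without isolated vertices. For a graph $G$, $A(G)$ is its adjacency matrix, $D(G)$ the diagonal matrix of vertex degrees, and $Q(G)=A(G)+D(G)$ its signless Laplacian matrix; $q(G)$ denotes the signless Laplacian spectral radius, i.e. the largest eigenvalue of $Q(G)$. The circumference of a graph is the maximum length of a cycle in it. *)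

theory Defs
  imports "Jordan_Normal_Form.Char_Poly" Complex_Main
begin

record 'a ugraph =
  verts :: "'a set"
  edges :: "'a set set"

definition simple_graph :: "'a ugraph \<Rightarrow> bool" where
  "simple_graph G \<longleftrightarrow> finite (verts G) \<and> (\<forall>e \<in> edges G. e \<subseteq> verts G \<and> card e = 2)"

definition no_isolated_vertices :: "'a ugraph \<Rightarrow> bool" where
  "no_isolated_vertices G \<longleftrightarrow> (\<forall>v \<in> verts G. \<exists>e \<in> edges G. v \<in> e)"

definition degree_in :: "'a ugraph \<Rightarrow> 'a \<Rightarrow> nat" where
  "degree_in G v = card {e \<in> edges G. v \<in> e}"

definition graph_iso :: "'a ugraph \<Rightarrow> 'b ugraph \<Rightarrow> bool" where
  "graph_iso G H \<longleftrightarrow> (\<exists>f. bij_betw f (verts G) (verts H) \<and>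
     (\<forall>u \<in> verts G. \<forall>v \<in> verts G. {u, v} \<in> edges G \<longleftrightarrow> {f u, f v} \<in> edges H))"

text \<open>A cycle is given by the list of its vertices in cyclic order, so its length is the length of
  the list.\<close>

definition is_cycle :: "'a ugraph \<Rightarrow> 'a list \<Rightarrow> bool" where
  "is_cycle G p \<longleftrightarrow> 3 \<le> length p \<and> distinct p \<and> set p \<subseteq> verts G \<and>
     (\<forall>i < length p. {p ! i, p ! (Suc i mod length p)} \<in> edges G)"

text \<open>The circumference of a forest is \<^term>\<open>0\<close> by convention.\<close>

definition circumference :: "'a ugraph \<Rightarrow> nat" where
  "circumference G = Max (insert 0 {length p | p. is_cycle G p})"

text \<open>Matrices are indexed by an arbitrary but fixed enumeration of the vertices; another
  enumeration gives a permutation-similar matrix, hence the same eigenvalues.\<close>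

definition vertex_list :: "'a ugraph \<Rightarrow> 'a list" where
  "vertex_list G = (SOME xs. distinct xs \<and> set xs = verts G)"

definition adjacency_matrix :: "'a ugraph \<Rightarrow> real mat" where
  "adjacency_matrix G = mat (card (verts G)) (card (verts G))
     (\<lambda>(i, j). if {vertex_list G ! i, vertex_list G ! j} \<in> edges G then 1 else 0)"

definition degree_matrix :: "'a ugraph \<Rightarrow> real mat" where
  "degree_matrix G = mat_diag (card (verts G)) (\<lambda>i. real (degree_in G (vertex_list G ! i)))"

definition signless_Laplacian :: "'a ugraph \<Rightarrow> real mat" where
  "signless_Laplacian G = adjacency_matrix G + degree_matrix G"

definition signless_Laplacian_radius :: "'a ugraph \<Rightarrow> real" where
  "signless_Laplacian_radius G = Max {k. eigenvalue (signless_Laplacian G) k}"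

definition graphs_with :: "nat \<Rightarrow> nat \<Rightarrow> 'a ugraph set" where
  "graphs_with m c = {G. simple_graph G \<and> no_isolated_vertices G \<and>
     card (edges G) = m \<and> circumference G = c}"

text \<open>The cycle is \<open>0, 1, \<dots>, c - 1\<close> and the chosen vertex on it is \<open>0\<close>, so the
  \<open>c - 3\<close> cycle vertices not adjacent to it are \<open>2, \<dots>, c - 2\<close>. The \<open>m - 2c + 3\<close> new
  vertices are \<open>c, c + 1, \<dots>, m - c + 2\<close>.\<close>

definition extremal_graph :: "nat \<Rightarrow> nat \<Rightarrow> nat ugraph" where
  "extremal_graph m c = \<lparr>
     verts = {0..<c + (m + 3 - 2 * c)},
     edges = {{i, Suc i mod c} | i. i < c}
           \<union> {{0, i} | i. 2 \<le> i \<and> i \<le> c - 2}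
           \<union> {{0, c + j} | j. j < m + 3 - 2 * c} \<rparr>"

end

theory Submission
  imports Defs "HOL-Analysis.Function_Topology"
begin

text \<open>Every vertex has degree at most \<open>m - c + 2\<close>, because a cycle of length \<open>c\<close> has at least \<open>c - 2\<close>
  edges that avoid a given vertex. The star at the hub of \<open>H\<^bsub>m,c\<^esub>\<close> shows \<open>q(H\<^bsub>m,c\<^esub>) > m - c + 3\<close>.
  If all degrees of \<open>H\<close> are at most \<open>m - c + 1\<close>, a positive vector \<open>y\<close> with \<open>Q y \<le> (m - c + 3) y\<close> gives
  \<open>q(H) \<le> m - c + 3\<close>: the degree vector if all degrees are at most \<open>m - c\<close>, and a vector concentrated
  at a vertex of degree \<open>m - c + 1\<close> otherwise (except for \<open>m = 5\<close>, \<open>c = 3\<close>, where the degree vector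
  still works because there is no 4-cycle). If some vertex \<open>v\<close> has degree \<open>m - c + 2\<close>, then \<open>H\<close> consists
  of the star at \<open>v\<close> and a path on \<open>c - 1\<close> vertices that closes up to a cycle through \<open>v\<close>. Identifying
  a path vertex not adjacent to \<open>v\<close> with a pendent neighbour of \<open>v\<close> keeps the number of edges and
  increases \<open>q\<close>; doing so for all such path vertices leads to \<open>H\<^bsub>m,c\<^esub>\<close>.\<close>

section \<open>Quadratic form and principal eigenvector\<close>

definition nbrs :: "'a set set \<Rightarrow> 'a \<Rightarrow> 'a set" where
  "nbrs E v = {w. {v, w} \<in> E}"

text \<open>The vector \<open>Q x\<close> at \<open>v\<close>, without matrices or an enumeration of
  the vertices: the diagonal entry of \<open>Q\<close> contributes \<open>x v\<close> once per
  neighbour.\<close>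

definition slap :: "'a set set \<Rightarrow> ('a \<Rightarrow> real) \<Rightarrow> 'a \<Rightarrow> real" where
  "slap E x v = (\<Sum>w\<in>nbrs E v. x v + x w)"

text \<open>The quadratic form of \<open>Q\<close>. Since \<open>Q\<close> is the vertex-edge
  incidence matrix times its transpose, the form is a sum of squares over the edges.\<close>

definition qform :: "'a set set \<Rightarrow> ('a \<Rightarrow> real) \<Rightarrow> real" where
  "qform E x = (\<Sum>e\<in>E. (sum x e)\<^sup>2)"

locale fin_graph =
  fixes V :: "'a set" and E :: "'a set set"
  assumes finite_V: "finite V"
    and edge_subset: "e \<in> E \<Longrightarrow> e \<subseteq> V"
    and card_edge: "e \<in> E \<Longrightarrow> card e = 2"
begin

lemma finite_E: "finite E"
  using finite_V edge_subset by (meson Pow_iff finite_Pow_iff finite_subset subsetI)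

lemma nbrs_subset: "nbrs E v \<subseteq> V"
  using edge_subset by (auto simp: nbrs_def)

lemma finite_nbrs: "finite (nbrs E v)"
  using nbrs_subset finite_V finite_subset by blast

lemma edgeE:
  assumes "e \<in> E"
  obtains u w where "e = {u, w}" "u \<noteq> w" "u \<in> V" "w \<in> V"
  using card_edge[OF assms] edge_subset[OF assms] by (auto simp: card_2_iff)

lemma edge_through:
  assumes "e \<in> E" "v \<in> e"
  obtains w where "e = {v, w}" "v \<noteq> w" "w \<in> nbrs E v"
proof -
  obtain a b where ab: "e = {a, b}" "a \<noteq> b" using edgeE[OF assms(1)] by metis
  show thesis
  proof (cases "v = a")
    case True
    then show thesis using that[of b] ab assms by (auto simp: nbrs_def)
  next
    case False
    then have "v = b" using ab assms by auto
    moreover have "{b, a} \<in> E" using ab assms by (simp add: insert_commute)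
    ultimately show thesis using that[of a] ab by (auto simp: nbrs_def)
  qed
qed

lemma not_nbr_self: "v \<notin> nbrs E v"
  using card_edge by (force simp: nbrs_def)

lemma nbrs_sym: "w \<in> nbrs E v \<longleftrightarrow> v \<in> nbrs E w"
  by (simp add: nbrs_def insert_commute)

lemma incident_eq_image: "{e \<in> E. v \<in> e} = (\<lambda>w. {v, w}) ` nbrs E v"
  by (auto simp: nbrs_def elim!: edge_through)

lemma inj_on_edge: "inj_on (\<lambda>w. {v, w}) (nbrs E v)"
  by (auto simp: inj_on_def doubleton_eq_iff)

lemma card_incident: "card {e \<in> E. v \<in> e} = card (nbrs E v)"
  unfolding incident_eq_image by (rule card_image[OF inj_on_edge])

lemma slap_eq_incident: "slap E x v = (\<Sum>e | e \<in> E \<and> v \<in> e. sum x e)"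
proof -
  have "(\<Sum>e | e \<in> E \<and> v \<in> e. sum x e) = (\<Sum>w\<in>nbrs E v. sum x {v, w})"
    unfolding incident_eq_image by (simp add: sum.reindex[OF inj_on_edge])
  also have "\<dots> = slap E x v"
    unfolding slap_def
  proof (intro sum.cong refl)
    fix w assume "w \<in> nbrs E v"
    then have "v \<noteq> w" using not_nbr_self by blast
    then show "sum x {v, w} = x v + x w" by simp
  qed
  finally show ?thesis by simp
qed

text \<open>Weighted double counting of incidences. With \<open>h = sum x\<close> it yields the
  symmetry of \<open>Q\<close>, with constant weights the handshake lemma.\<close>

lemma sum_swap_incident:
  fixes g :: "'a \<Rightarrow> real"
  shows "(\<Sum>v\<in>V. g v * (\<Sum>e | e \<in> E \<and> v \<in> e. h e)) = (\<Sum>e\<in>E. sum g e * h e)"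
proof -
  have "(\<Sum>v\<in>V. g v * (\<Sum>e | e \<in> E \<and> v \<in> e. h e))
      = (\<Sum>v\<in>V. \<Sum>e\<in>E. if v \<in> e then g v * h e else 0)"
    using finite_E
    by (simp add: sum_distrib_left sum.inter_filter if_distrib[of "\<lambda>t. _ * t"] cong: if_cong)
  also have "\<dots> = (\<Sum>e\<in>E. \<Sum>v\<in>V. if v \<in> e then g v * h e else 0)"
    by (rule sum.swap)
  also have "\<dots> = (\<Sum>e\<in>E. sum g e * h e)"
  proof (rule sum.cong)
    fix e assume e: "e \<in> E"
    have "{v \<in> V. v \<in> e} = e" using edge_subset[OF e] by auto
    then show "(\<Sum>v\<in>V. if v \<in> e then g v * h e else 0) = sum g e * h e"
      using finite_V by (simp add: sum.inter_filter[symmetric] sum_distrib_right)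
  qed simp
  finally show ?thesis .
qed

lemma inner_slap: "(\<Sum>v\<in>V. y v * slap E x v) = (\<Sum>e\<in>E. sum y e * sum x e)"
  by (simp add: slap_eq_incident sum_swap_incident)

lemma slap_symmetric: "(\<Sum>v\<in>V. y v * slap E x v) = (\<Sum>v\<in>V. x v * slap E y v)"
  by (simp add: inner_slap mult.commute)

lemma qform_eq_inner: "qform E x = (\<Sum>v\<in>V. x v * slap E x v)"
  by (simp add: qform_def inner_slap power2_eq_square)

lemma sum_degrees: "(\<Sum>v\<in>V. card (nbrs E v)) = 2 * card E"
proof -
  have "(\<Sum>v\<in>V. real (card (nbrs E v))) = (\<Sum>v\<in>V. 1 * (\<Sum>e | e \<in> E \<and> v \<in> e. 1))"
    by (simp add: card_incident)
  also have "\<dots> = (\<Sum>e\<in>E. 2)"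
    unfolding sum_swap_incident using card_edge by (intro sum.cong) auto
  finally have "real (\<Sum>v\<in>V. card (nbrs E v)) = real (2 * card E)" by simp
  then show ?thesis by (simp only: of_nat_eq_iff)
qed

text \<open>A vertex is not its own neighbour, so its degree can be split off from the handshake sum
  before restricting to the neighbours.\<close>

lemma sum_nbr_degrees_le:
  "v \<in> V \<Longrightarrow> (\<Sum>w\<in>nbrs E v. card (nbrs E w)) + card (nbrs E v) \<le> 2 * card E"
proof -
  assume v: "v \<in> V"
  have "(\<Sum>w\<in>nbrs E v. card (nbrs E w)) \<le> (\<Sum>w\<in>V - {v}. card (nbrs E w))"
    using nbrs_subset[of v] not_nbr_self[of v] finite_V by (intro sum_mono2) auto
  moreover have "(\<Sum>w\<in>V. card (nbrs E w)) = card (nbrs E v) + (\<Sum>w\<in>V - {v}. card (nbrs E w))"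
    using v finite_V by (rule sum.remove[rotated])
  ultimately show ?thesis using sum_degrees by linarith
qed

lemma degree_le_card_E: "card (nbrs E v) \<le> card E"
  unfolding card_incident[symmetric] by (intro card_mono finite_E) auto

end

section \<open>Existence of a nonnegative principal eigenvector\<close>

lemma real_quadratic_nonneg_imp_linear_0:
  fixes a b :: real
  assumes "\<And>t. 0 \<le> a * t + b * t\<^sup>2"
  shows "a = 0"
proof (rule ccontr)
  assume a: "a \<noteq> 0"
  \<comment> \<open>At \<open>t = - a / B\<close> the value is
    \<open>(a\<^sup>2 / B\<^sup>2) * (b - B)\<close>, negative because \<open>B\<close> exceeds
    \<open>b\<close>.\<close>
  define B where "B = \<bar>b\<bar> + 1"
  have B: "B > 0" "b < B" by (auto simp: B_def)
  have "0 \<le> a * (- a / B) + b * (- a / B)\<^sup>2" by (rule assms)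
  also have "\<dots> = (a\<^sup>2 / B\<^sup>2) * (b - B)" using B by (simp add: power2_eq_square field_simps)
  also have "\<dots> < 0" using a B by (intro mult_pos_neg) auto
  finally show False by simp
qed

text \<open>Tychonoff's theorem in the full function space. Coordinates outside \<open>V\<close> are
  pinned to 0; left free they would destroy compactness.\<close>

lemma compact_box_fun:
  fixes V :: "'a set"
  shows "compact {x :: 'a \<Rightarrow> real. (\<forall>v\<in>V. x v \<in> {-1..1}) \<and> (\<forall>v. v \<notin> V \<longrightarrow> x v = 0)}"
proof -
  have "compactin (product_topology (\<lambda>_::'a. euclidean :: real topology) UNIV)
      (PiE UNIV (\<lambda>v. if v \<in> V then {-1..1} else {0}))"
    unfolding compactin_PiE by auto
  moreover have "PiE UNIV (\<lambda>v. if v \<in> V then {-1..1} else {0})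
      = {x :: 'a \<Rightarrow> real. (\<forall>v\<in>V. x v \<in> {-1..1}) \<and> (\<forall>v. v \<notin> V \<longrightarrow> x v = 0)}"
    by (auto simp: PiE_iff split: if_splits)
  ultimately show ?thesis by (simp add: euclidean_product_topology)
qed

context fin_graph
begin

lemma qform_maximizer:
  assumes "V \<noteq> {}"
  obtains x where "(\<Sum>v\<in>V. (x v)\<^sup>2) = 1"
    "\<And>y. (\<Sum>v\<in>V. (y v)\<^sup>2) = 1 \<Longrightarrow> qform E y \<le> qform E x"
proof -
  let ?B = "{x :: 'a \<Rightarrow> real. (\<forall>v\<in>V. x v \<in> {-1..1}) \<and> (\<forall>v. v \<notin> V \<longrightarrow> x v = 0)}"
  let ?S = "{x. (\<Sum>v\<in>V. (x v)\<^sup>2) = (1::real)}"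
  have cont: "continuous_on S (\<lambda>x::'a \<Rightarrow> real. x v)" for S v
    by (rule continuous_on_subset[OF continuous_on_product_coordinates]) simp
  have "closed ?S"
    by (intro closed_Collect_eq continuous_intros cont)
  define K where "K = ?B \<inter> ?S"
  have "compact K"
    unfolding K_def using \<open>closed ?S\<close> by (intro compact_Int_closed compact_box_fun)
  obtain v0 where v0: "v0 \<in> V" using assms by auto
  have "(\<lambda>v. if v = v0 then 1 else 0) \<in> K"
    using v0 finite_V by (auto simp: K_def if_distrib[of "\<lambda>t. t\<^sup>2"] cong: if_cong)
  then have "K \<noteq> {}" by blast
  have "continuous_on K (qform E)"
    unfolding qform_def by (intro continuous_intros cont)
  obtain x where x: "x \<in> K" "\<And>y. y \<in> K \<Longrightarrow> qform E y \<le> qform E x"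
    using continuous_attains_sup[OF \<open>compact K\<close> \<open>K \<noteq> {}\<close> \<open>continuous_on K (qform E)\<close>] by blast
  have "qform E y \<le> qform E x" if y: "(\<Sum>v\<in>V. (y v)\<^sup>2) = 1" for y
  proof -
    \<comment> \<open>A competitor need not vanish outside \<open>V\<close>. Cutting it off there
      changes neither its norm nor its form.\<close>
    define y' where "y' = (\<lambda>v. if v \<in> V then y v else 0)"
    have "\<bar>y v\<bar> \<le> 1" if "v \<in> V" for v
    proof -
      have "(y v)\<^sup>2 \<le> (\<Sum>v\<in>V. (y v)\<^sup>2)" using that finite_V by (intro member_le_sum) auto
      then show ?thesis using y by (simp add: abs_square_le_1)
    qed
    then have "y' \<in> K"
      using y by (simp add: K_def y'_def abs_le_iff minus_le_iff)
    then have "qform E y' \<le> qform E x" using x by blast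
    moreover have "sum y' e = sum y e" if "e \<in> E" for e
      using edge_subset[OF that] by (intro sum.cong) (auto simp: y'_def)
    then have "qform E y' = qform E y" by (simp add: qform_def)
    ultimately show ?thesis by simp
  qed
  then show thesis using that[of x] x(1) by (simp add: K_def)
qed

lemma qform_scale: "qform E (\<lambda>v. a * x v) = a\<^sup>2 * qform E x"
  by (simp add: qform_def sum_distrib_left[symmetric] power_mult_distrib)

text \<open>The Rayleigh quotient attains its maximum \<open>q\<close>. The absolute values of a
  maximizer again form a maximizer, and stationarity in each coordinate direction is the eigenvalue
  equation.\<close>

lemma principal_eigenvector:
  assumes "V \<noteq> {}"
  obtains q x where "\<And>v. 0 \<le> x v" "(\<Sum>v\<in>V. (x v)\<^sup>2) = 1"
    "\<And>v. v \<in> V \<Longrightarrow> slap E x v = q * x v"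
    "\<And>y. qform E y \<le> q * (\<Sum>v\<in>V. (y v)\<^sup>2)"
proof -
  obtain x0 where x0: "(\<Sum>v\<in>V. (x0 v)\<^sup>2) = 1"
    "\<And>y. (\<Sum>v\<in>V. (y v)\<^sup>2) = 1 \<Longrightarrow> qform E y \<le> qform E x0"
    using qform_maximizer[OF assms] by metis
  define q where "q = qform E x0"
  define x where "x = (\<lambda>v. \<bar>x0 v\<bar>)"
  have ray: "qform E y \<le> q * (\<Sum>v\<in>V. (y v)\<^sup>2)" for y
  proof (cases "(\<Sum>v\<in>V. (y v)\<^sup>2) = 0")
    case True
    then have "y v = 0" if "v \<in> V" for v using that finite_V by (simp add: sum_nonneg_eq_0_iff)
    then have "sum y e = 0" if "e \<in> E" for e
      using edge_subset[OF that] by (intro sum.neutral) auto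
    then show ?thesis using True by (simp add: qform_def)
  next
    case False
    define s where "s = (\<Sum>v\<in>V. (y v)\<^sup>2)"
    have s: "s > 0" using False by (simp add: s_def sum_nonneg order_less_le)
    define a where "a = 1 / sqrt s"
    have a: "a\<^sup>2 = 1 / s" using s by (simp add: a_def power_divide)
    have n1: "(\<Sum>v\<in>V. (a * y v)\<^sup>2) = 1"
      using s unfolding power_mult_distrib sum_distrib_left[symmetric] a s_def[symmetric] by simp
    have "qform E (\<lambda>v. a * y v) \<le> q" using x0(2)[OF n1] by (simp add: q_def)
    then have "qform E y / s \<le> q" by (simp add: qform_scale a)
    then show ?thesis using s by (simp add: s_def[symmetric] pos_divide_le_eq)
  qed
  have xn: "(\<Sum>v\<in>V. (x v)\<^sup>2) = 1" using x0(1) by (simp add: x_def)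
  have "qform E x0 \<le> qform E x"
    unfolding qform_def x_def
  proof (intro sum_mono)
    fix e
    have "\<bar>sum x0 e\<bar> \<le> (\<Sum>v\<in>e. \<bar>x0 v\<bar>)" by (rule sum_abs)
    then show "(sum x0 e)\<^sup>2 \<le> (\<Sum>v\<in>e. \<bar>x0 v\<bar>)\<^sup>2"
      by (metis abs_ge_zero power2_abs power_mono)
  qed
  then have qx: "qform E x = q" using ray[of x] xn q_def by simp
  have eig: "slap E x v = q * x v" if v: "v \<in> V" for v
  proof -
    \<comment> \<open>The direction \<open>y\<close> is the unit vector at \<open>v\<close>. The
      Rayleigh bound at \<open>x + t y\<close> says that a quadratic in \<open>t\<close> without
      constant term is nonnegative, so its linear coefficient vanishes.\<close>
    define y where "y = (\<lambda>u. if u = v then 1 else (0::real))"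
    define b where "b = q * (\<Sum>u\<in>V. (y u)\<^sup>2) - qform E y"
    have "0 \<le> 2 * (q * x v - slap E x v) * t + b * t\<^sup>2" for t
    proof -
      have "(\<Sum>u\<in>V. (x u + t * y u)\<^sup>2)
          = (\<Sum>u\<in>V. (x u)\<^sup>2) + 2 * t * (\<Sum>u\<in>V. y u * x u) + t\<^sup>2 * (\<Sum>u\<in>V. (y u)\<^sup>2)"
        unfolding sum_distrib_left sum.distrib[symmetric]
        by (intro sum.cong) (auto simp: power2_eq_square algebra_simps)
      moreover have "(\<Sum>u\<in>V. y u * x u) = x v"
        using v finite_V by (simp add: y_def if_distrib[of "\<lambda>a. a * _"] cong: if_cong)
      ultimately have n: "(\<Sum>u\<in>V. (x u + t * y u)\<^sup>2) = 1 + 2 * t * x v + t\<^sup>2 * (\<Sum>u\<in>V. (y u)\<^sup>2)"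
        using xn by simp
      have "qform E (\<lambda>u. x u + t * y u)
          = qform E x + 2 * t * (\<Sum>e\<in>E. sum y e * sum x e) + t\<^sup>2 * qform E y"
        unfolding qform_def sum_distrib_left sum.distrib[symmetric]
        by (intro sum.cong refl)
          (simp add: sum.distrib sum_distrib_left[symmetric], simp add: power2_eq_square algebra_simps)
      moreover have "(\<Sum>e\<in>E. sum y e * sum x e) = slap E x v"
        unfolding inner_slap[symmetric]
        using v finite_V by (simp add: y_def if_distrib[of "\<lambda>a. a * _"] cong: if_cong)
      ultimately have f: "qform E (\<lambda>u. x u + t * y u) = q + 2 * t * slap E x v + t\<^sup>2 * qform E y"
        using qx by simp
      show ?thesis using ray[of "\<lambda>u. x u + t * y u"] unfolding n f b_def
        by (simp add: algebra_simps)
    qed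
    from real_quadratic_nonneg_imp_linear_0[OF this] show ?thesis by simp
  qed
  show thesis using that[of x q] xn eig ray by (simp add: x_def)
qed

end

section \<open>The signless Laplacian radius\<close>

lemma simple_graph_imp_fin_graph: "simple_graph G \<Longrightarrow> fin_graph (verts G) (edges G)"
  by (unfold_locales) (auto simp: simple_graph_def)

lemma vertex_list:
  assumes "finite (verts G)"
  shows "distinct (vertex_list G)" "set (vertex_list G) = verts G"
    "length (vertex_list G) = card (verts G)"
proof -
  have *: "distinct (vertex_list G) \<and> set (vertex_list G) = verts G"
    unfolding vertex_list_def
    by (rule someI_ex) (use finite_distinct_list[OF assms] in blast)
  then show "distinct (vertex_list G)" "set (vertex_list G) = verts G" by auto
  show "length (vertex_list G) = card (verts G)" using * distinct_card by fastforce
qed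

lemma signless_Laplacian_carrier:
  "signless_Laplacian G \<in> carrier_mat (card (verts G)) (card (verts G))"
  by (auto simp: signless_Laplacian_def adjacency_matrix_def degree_matrix_def mat_diag_def)

lemma signless_Laplacian_mult_vec:
  assumes G: "simple_graph G" and i: "i < card (verts G)"
  shows "(signless_Laplacian G *\<^sub>v Matrix.vec (card (verts G)) (\<lambda>i. x (vertex_list G ! i))) $ i
    = slap (edges G) x (vertex_list G ! i)"
proof -
  interpret fin_graph "verts G" "edges G" using G by (rule simple_graph_imp_fin_graph)
  let ?n = "card (verts G)" and ?l = "vertex_list G" and ?E = "edges G"
  note l = vertex_list[OF finite_V]
  have bij: "bij_betw ((!) ?l) {..<?n} (verts G)"
    using l by (intro bij_betw_nth) auto
  have "(signless_Laplacian G *\<^sub>v Matrix.vec ?n (\<lambda>i. x (?l ! i))) $ i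
     = (\<Sum>j<?n. ((if {?l ! i, ?l ! j} \<in> ?E then 1 else 0)
          + (if i = j then real (degree_in G (?l ! j)) else 0)) * x (?l ! j))"
    using i by (auto simp: signless_Laplacian_def adjacency_matrix_def degree_matrix_def
        mat_diag_def scalar_prod_def atLeast0LessThan intro!: sum.cong)
  also have "\<dots> = (\<Sum>j<?n. if {?l ! i, ?l ! j} \<in> ?E then x (?l ! j) else 0)
      + (\<Sum>j<?n. if i = j then real (degree_in G (?l ! j)) * x (?l ! j) else 0)"
    unfolding sum.distrib[symmetric] by (intro sum.cong) (auto simp: distrib_right)
  also have "(\<Sum>j<?n. if {?l ! i, ?l ! j} \<in> ?E then x (?l ! j) else 0)
      = (\<Sum>w\<in>verts G. if {?l ! i, w} \<in> ?E then x w else 0)"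
    by (rule sum.reindex_bij_betw[OF bij])
  also have "\<dots> = (\<Sum>w\<in>{w \<in> verts G. {?l ! i, w} \<in> ?E}. x w)"
    using finite_V by (simp add: sum.inter_filter)
  also have "{w \<in> verts G. {?l ! i, w} \<in> ?E} = nbrs ?E (?l ! i)"
    using nbrs_subset[of "?l ! i"] by (auto simp: nbrs_def)
  also have "(\<Sum>j<?n. if i = j then real (degree_in G (?l ! j)) * x (?l ! j) else 0)
      = real (card (nbrs ?E (?l ! i))) * x (?l ! i)"
    using i by (simp add: degree_in_def card_incident)
  finally show ?thesis by (simp add: slap_def sum.distrib)
qed

text \<open>Eliminates the arbitrary enumeration behind the matrix: eigenvectors become functions on
  the vertices.\<close>

lemma eigenvalue_signless_Laplacian_iff:
  assumes G: "simple_graph G"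
  shows "eigenvalue (signless_Laplacian G) k \<longleftrightarrow>
    (\<exists>x. (\<exists>v\<in>verts G. x v \<noteq> 0) \<and> (\<forall>v\<in>verts G. slap (edges G) x v = k * x v))"
    (is "?L \<longleftrightarrow> ?R")
proof
  let ?n = "card (verts G)" and ?l = "vertex_list G"
  have fin: "finite (verts G)" using G by (simp add: simple_graph_def)
  note l = vertex_list[OF fin]
  have dim: "dim_row (signless_Laplacian G) = ?n" "dim_col (signless_Laplacian G) = ?n"
    using signless_Laplacian_carrier[of G] by auto
  {
    assume ?L
    then obtain z where z: "z \<in> carrier_vec ?n" "z \<noteq> 0\<^sub>v ?n"
      "signless_Laplacian G *\<^sub>v z = k \<cdot>\<^sub>v z"
      by (auto simp: eigenvalue_def eigenvector_def dim)
    define x where "x = (\<lambda>w. z $ (inv_into {..<?n} ((!) ?l) w))"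
    have bij: "bij_betw ((!) ?l) {..<?n} (verts G)"
      using l by (intro bij_betw_nth) auto
    have x: "x (?l ! i) = z $ i" if "i < ?n" for i
      using bij_betw_inv_into_left[OF bij, of i] that by (simp add: x_def)
    have zx: "Matrix.vec ?n (\<lambda>i. x (?l ! i)) = z"
      using z(1) x by (intro eq_vecI) auto
    have "slap (edges G) x (?l ! i) = k * x (?l ! i)" if "i < ?n" for i
      using signless_Laplacian_mult_vec[OF G that, of x] z that by (simp add: zx x)
    moreover have "\<exists>i<?n. ?l ! i = v" if "v \<in> verts G" for v
      using that l by (metis in_set_conv_nth)
    ultimately have "\<forall>v\<in>verts G. slap (edges G) x v = k * x v" by metis
    moreover obtain i where i: "i < ?n" "z $ i \<noteq> 0"
      using z(1,2) eq_vecI[of z "0\<^sub>v ?n"] by fastforce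
    then have "\<exists>v\<in>verts G. x v \<noteq> 0" using x l by (metis nth_mem)
    ultimately show ?R by blast
  next
    assume ?R
    then obtain x v where x: "\<And>v. v \<in> verts G \<Longrightarrow> slap (edges G) x v = k * x v"
      and v: "v \<in> verts G" "x v \<noteq> 0" by blast
    define z where "z = Matrix.vec ?n (\<lambda>i. x (?l ! i))"
    have "signless_Laplacian G *\<^sub>v z = k \<cdot>\<^sub>v z"
    proof (rule eq_vecI)
      fix i assume "i < dim_vec (k \<cdot>\<^sub>v z)"
      then have i: "i < ?n" by (simp add: z_def)
      then have "?l ! i \<in> verts G" using l by (metis nth_mem)
      then show "(signless_Laplacian G *\<^sub>v z) $ i = (k \<cdot>\<^sub>v z) $ i"
        using signless_Laplacian_mult_vec[OF G i, of x] x i by (simp add: z_def)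
    qed (simp add: dim z_def)
    moreover obtain i where "i < ?n" "?l ! i = v" using v l by (metis in_set_conv_nth)
    then have "z $ i \<noteq> 0" "i < ?n" using v by (auto simp: z_def)
    then have "z \<noteq> 0\<^sub>v ?n" by (metis index_zero_vec(1))
    ultimately show ?L
      unfolding eigenvalue_def eigenvector_def dim by (intro exI[of _ z]) (simp add: z_def)
  }
qed

lemma finite_eigenvalues:
  fixes A :: "'b :: field mat"
  assumes "A \<in> carrier_mat n n"
  shows "finite {k. eigenvalue A k}"
proof -
  have "char_poly A \<noteq> 0" using degree_monic_char_poly[OF assms] by auto
  then show ?thesis
    using poly_roots_finite by (simp add: eigenvalue_root_char_poly[OF assms])
qed

text \<open>The Rayleigh maximum is an eigenvalue, and it bounds every eigenvalue \<open>k\<close>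
  because an eigenvector for \<open>k\<close> has Rayleigh quotient \<open>k\<close>. The
  \<open>Max\<close> ranges over finitely many roots of the characteristic polynomial.\<close>

lemma signless_Laplacian_radius:
  assumes G: "simple_graph G" and ne: "verts G \<noteq> {}"
  obtains x where "\<And>v. 0 \<le> x v" "(\<Sum>v\<in>verts G. (x v)\<^sup>2) = 1"
    "\<And>v. v \<in> verts G \<Longrightarrow> slap (edges G) x v = signless_Laplacian_radius G * x v"
    "\<And>y. qform (edges G) y \<le> signless_Laplacian_radius G * (\<Sum>v\<in>verts G. (y v)\<^sup>2)"
proof -
  interpret fin_graph "verts G" "edges G" using G by (rule simple_graph_imp_fin_graph)
  obtain q x where x: "\<And>v. 0 \<le> x v" "(\<Sum>v\<in>verts G. (x v)\<^sup>2) = 1"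
    "\<And>v. v \<in> verts G \<Longrightarrow> slap (edges G) x v = q * x v"
    and ray: "\<And>y. qform (edges G) y \<le> q * (\<Sum>v\<in>verts G. (y v)\<^sup>2)"
    using principal_eigenvector[OF ne] by metis
  have "\<exists>v\<in>verts G. x v \<noteq> 0"
  proof (rule ccontr)
    assume "\<not> ?thesis"
    then have "(\<Sum>v\<in>verts G. (x v)\<^sup>2) = 0" by (intro sum.neutral) auto
    with x(2) show False by simp
  qed
  then have "eigenvalue (signless_Laplacian G) q"
    using x(3) unfolding eigenvalue_signless_Laplacian_iff[OF G] by blast
  moreover have "k \<le> q" if ev: "eigenvalue (signless_Laplacian G) k" for k
  proof -
    obtain y v where y: "\<And>v. v \<in> verts G \<Longrightarrow> slap (edges G) y v = k * y v"
      and v: "v \<in> verts G" "y v \<noteq> 0"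
      using ev unfolding eigenvalue_signless_Laplacian_iff[OF G] by blast
    have "k * (\<Sum>v\<in>verts G. (y v)\<^sup>2) = qform (edges G) y"
      unfolding qform_eq_inner sum_distrib_left
      by (intro sum.cong refl) (simp add: y power2_eq_square)
    also have "\<dots> \<le> q * (\<Sum>v\<in>verts G. (y v)\<^sup>2)" by (rule ray)
    finally have "k * (\<Sum>v\<in>verts G. (y v)\<^sup>2) \<le> q * (\<Sum>v\<in>verts G. (y v)\<^sup>2)" .
    moreover have "0 < (\<Sum>v\<in>verts G. (y v)\<^sup>2)"
      using v finite_V by (intro sum_pos2[of _ v]) auto
    ultimately show "k \<le> q" by (rule mult_right_le_imp_le)
  qed
  ultimately have "signless_Laplacian_radius G = q"
    unfolding signless_Laplacian_radius_def
    using finite_eigenvalues[OF signless_Laplacian_carrier[of G]] by (intro Max_eqI) auto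
  then show thesis using that[of x] x ray by simp
qed

text \<open>Collatz-Wielandt bound: pair \<open>y\<close> with the nonnegative principal eigenvector
  and move \<open>Q\<close> across by symmetry. Positivity of \<open>y\<close> makes the inner
  product positive, so it can be cancelled.\<close>

lemma signless_Laplacian_radius_le:
  assumes G: "simple_graph G" and ne: "verts G \<noteq> {}"
    and pos: "\<And>v. v \<in> verts G \<Longrightarrow> 0 < y v"
    and le: "\<And>v. v \<in> verts G \<Longrightarrow> slap (edges G) y v \<le> k * y v"
  shows "signless_Laplacian_radius G \<le> k"
proof -
  interpret fin_graph "verts G" "edges G" using G by (rule simple_graph_imp_fin_graph)
  let ?V = "verts G" and ?E = "edges G" and ?q = "signless_Laplacian_radius G"
  obtain x where x: "\<And>v. 0 \<le> x v" "(\<Sum>v\<in>?V. (x v)\<^sup>2) = 1"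
    "\<And>v. v \<in> ?V \<Longrightarrow> slap ?E x v = ?q * x v"
    using signless_Laplacian_radius[OF G ne] by metis
  obtain v where v: "v \<in> ?V" "x v \<noteq> 0"
    using x(2) sum.neutral[of ?V "\<lambda>v. (x v)\<^sup>2"] by fastforce
  have "0 < x v * y v" using v x(1)[of v] pos by (simp add: order_less_le)
  then have pos': "0 < (\<Sum>v\<in>?V. x v * y v)"
    using v x(1) pos finite_V by (intro sum_pos2[of _ v]) (auto intro: mult_nonneg_nonneg less_imp_le)
  have "?q * (\<Sum>v\<in>?V. x v * y v) = (\<Sum>v\<in>?V. y v * slap ?E x v)"
    unfolding sum_distrib_left by (intro sum.cong refl) (simp add: x(3))
  also have "\<dots> = (\<Sum>v\<in>?V. x v * slap ?E y v)" by (rule slap_symmetric)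
  also have "\<dots> \<le> (\<Sum>v\<in>?V. x v * (k * y v))"
    by (intro sum_mono mult_left_mono le x)
  also have "\<dots> = k * (\<Sum>v\<in>?V. x v * y v)"
    unfolding sum_distrib_left by (intro sum.cong refl) simp
  finally show ?thesis using pos' by simp
qed

text \<open>An isomorphism maps neighbourhoods bijectively, so an eigenvector of \<open>H\<close>
  pulls back to one of \<open>G\<close>.\<close>

lemma graph_iso_eigenvalue:
  fixes G :: "'a ugraph" and H :: "'b ugraph"
  assumes G: "simple_graph G" and H: "simple_graph H" and iso: "graph_iso G H"
    and ev: "eigenvalue (signless_Laplacian H) k"
  shows "eigenvalue (signless_Laplacian G) k"
proof -
  interpret G: fin_graph "verts G" "edges G" using G by (rule simple_graph_imp_fin_graph)
  interpret H: fin_graph "verts H" "edges H" using H by (rule simple_graph_imp_fin_graph)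
  obtain f where f: "bij_betw f (verts G) (verts H)"
    "\<And>u v. u \<in> verts G \<Longrightarrow> v \<in> verts G \<Longrightarrow> {u, v} \<in> edges G \<longleftrightarrow> {f u, f v} \<in> edges H"
    using iso unfolding graph_iso_def by metis
  obtain x v where x: "\<And>v. v \<in> verts H \<Longrightarrow> slap (edges H) x v = k * x v"
    and v: "v \<in> verts H" "x v \<noteq> 0"
    using ev unfolding eigenvalue_signless_Laplacian_iff[OF H] by blast
  have "slap (edges G) (x \<circ> f) u = k * (x \<circ> f) u" if u: "u \<in> verts G" for u
  proof -
    have "bij_betw f (nbrs (edges G) u) (nbrs (edges H) (f u))"
    proof (rule bij_betw_subset[OF f(1) G.nbrs_subset])
      have "w \<in> f ` nbrs (edges G) u" if w: "w \<in> nbrs (edges H) (f u)" for w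
      proof -
        have "w \<in> verts H" using w H.nbrs_subset by blast
        then obtain w' where w': "w' \<in> verts G" "w = f w'" using f(1) by (auto simp: bij_betw_def)
        then have "w' \<in> nbrs (edges G) u" using f(2)[OF u w'(1)] w by (simp add: nbrs_def)
        then show ?thesis using w' by blast
      qed
      moreover have "f w \<in> nbrs (edges H) (f u)" if w: "w \<in> nbrs (edges G) u" for w
      proof -
        have "w \<in> verts G" using w G.nbrs_subset by blast
        then show ?thesis using f(2)[OF u] w by (simp add: nbrs_def)
      qed
      ultimately show "f ` nbrs (edges G) u = nbrs (edges H) (f u)" by blast
    qed
    then have "slap (edges G) (x \<circ> f) u = slap (edges H) x (f u)"
      unfolding slap_def comp_def by (rule sum.reindex_bij_betw)
    then show ?thesis using x f(1) u by (simp add: bij_betw_apply)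
  qed
  moreover have "v \<in> f ` verts G" using v(1) f(1) by (simp add: bij_betw_def)
  then obtain u where u: "v = f u" "u \<in> verts G" by (rule imageE)
  have "\<exists>u\<in>verts G. (x \<circ> f) u \<noteq> 0"
    using v(2) u by (intro bexI[of _ u]) simp_all
  ultimately show ?thesis unfolding eigenvalue_signless_Laplacian_iff[OF G] by blast
qed

lemma graph_iso_sym:
  assumes "graph_iso G H"
  shows "graph_iso H G"
proof -
  obtain f where f: "bij_betw f (verts G) (verts H)"
    "\<And>u v. u \<in> verts G \<Longrightarrow> v \<in> verts G \<Longrightarrow> {u, v} \<in> edges G \<longleftrightarrow> {f u, f v} \<in> edges H"
    using assms unfolding graph_iso_def by metis
  let ?g = "inv_into (verts G) f"
  have g: "bij_betw ?g (verts H) (verts G)" by (rule bij_betw_inv_into[OF f(1)])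
  have "{u, v} \<in> edges H \<longleftrightarrow> {?g u, ?g v} \<in> edges G" if "u \<in> verts H" "v \<in> verts H" for u v
    using f(2)[of "?g u" "?g v"] that g bij_betw_inv_into_right[OF f(1)] by (simp add: bij_betw_apply)
  with g show ?thesis unfolding graph_iso_def by blast
qed

lemma signless_Laplacian_radius_iso:
  assumes "simple_graph G" "simple_graph H" "graph_iso G H"
  shows "signless_Laplacian_radius G = signless_Laplacian_radius H"
  unfolding signless_Laplacian_radius_def
  using graph_iso_eigenvalue[OF assms] graph_iso_eigenvalue[OF assms(2,1) graph_iso_sym[OF assms(3)]]
  by (intro arg_cong[of _ _ Max]) blast

section \<open>Graphs without a dominating hub\<close>

lemma (in fin_graph) slap_degree:
  "slap E (\<lambda>u. real (card (nbrs E u))) v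
    = real (card (nbrs E v) * card (nbrs E v) + (\<Sum>w\<in>nbrs E v. card (nbrs E w)))"
  by (simp add: slap_def sum.distrib)

lemma (in fin_graph) fin_graph_subset: "F \<subseteq> E \<Longrightarrow> fin_graph V F"
  using finite_V edge_subset card_edge by unfold_locales auto

lemma (in fin_graph) card_edges_split:
  "card E = card (nbrs E v) + card {a \<in> E. v \<notin> a}"
  unfolding card_incident[symmetric] using finite_E
  by (subst card_Un_disjoint[symmetric]) (auto intro: arg_cong[of _ _ card])

lemma no_isolated_vertices_nbrs:
  assumes G: "simple_graph G" and "no_isolated_vertices G" "v \<in> verts G"
  shows "nbrs (edges G) v \<noteq> {}"
proof -
  interpret fin_graph "verts G" "edges G" using G by (rule simple_graph_imp_fin_graph)
  obtain e where "e \<in> edges G" "v \<in> e" using assms by (auto simp: no_isolated_vertices_def)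
  then show ?thesis using edge_through by blast
qed

text \<open>The Collatz-Wielandt bound with the degrees as test vector, positive because no vertex
  is isolated. The hypothesis bounds degree plus average neighbour degree by \<open>k\<close>,
  cleared of the denominator.\<close>

lemma radius_le_of_degree_vector:
  assumes G: "simple_graph G" and ni: "no_isolated_vertices G" and ne: "verts G \<noteq> {}"
    and le: "\<And>v. v \<in> verts G \<Longrightarrow> card (nbrs (edges G) v) * card (nbrs (edges G) v)
        + (\<Sum>w\<in>nbrs (edges G) v. card (nbrs (edges G) w)) \<le> k * card (nbrs (edges G) v)"
  shows "signless_Laplacian_radius G \<le> real k"
proof -
  interpret fin_graph "verts G" "edges G" using G by (rule simple_graph_imp_fin_graph)
  show ?thesis
  proof (rule signless_Laplacian_radius_le[OF G ne])
    fix v assume v: "v \<in> verts G"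
    show "0 < real (card (nbrs (edges G) v))"
      using no_isolated_vertices_nbrs[OF G ni v] finite_nbrs by (simp add: card_gt_0_iff)
    show "slap (edges G) (\<lambda>u. real (card (nbrs (edges G) u))) v
        \<le> real k * real (card (nbrs (edges G) v))"
      unfolding slap_degree of_nat_mult[symmetric] of_nat_le_iff by (rule le[OF v])
  qed
qed

text \<open>At a vertex of degree at most 3 each neighbour degree is bounded by \<open>D\<close>; at
  a larger degree the handshake bound with at most \<open>2 * D\<close> edges takes over.\<close>

lemma radius_le_max_degree_plus_3:
  assumes G: "simple_graph G" and ni: "no_isolated_vertices G" and ne: "verts G \<noteq> {}"
    and D: "\<And>v. v \<in> verts G \<Longrightarrow> card (nbrs (edges G) v) \<le> D"
    and m: "card (edges G) \<le> 2 * D \<or> D \<le> 3"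
  shows "signless_Laplacian_radius G \<le> real (D + 3)"
proof (rule radius_le_of_degree_vector[OF G ni ne])
  interpret fin_graph "verts G" "edges G" using G by (rule simple_graph_imp_fin_graph)
  fix v assume v: "v \<in> verts G"
  let ?d = "card (nbrs (edges G) v)" and ?s = "\<Sum>w\<in>nbrs (edges G) v. card (nbrs (edges G) w)"
  show "?d * ?d + ?s \<le> (D + 3) * ?d"
  proof (cases "?d \<le> 3")
    case True
    have "?s \<le> (\<Sum>w\<in>nbrs (edges G) v. D)"
      using D nbrs_subset[of v] by (intro sum_mono) blast
    then have "?s \<le> D * ?d" by (simp add: mult.commute)
    moreover have "?d * ?d \<le> 3 * ?d" using True by (rule mult_right_mono) simp
    ultimately show ?thesis unfolding distrib_right by linarith
  next
    case False
    then have m': "card (edges G) \<le> 2 * D" using m D[OF v] by linarith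
    have "4 \<le> ?d" using False by simp
    \<comment> \<open>After these substitutions the inequality reduces to
      \<open>4 * b \<le> ?d * b\<close>.\<close>
    then obtain a where a: "?d = 4 + a" using le_iff_add by blast
    obtain b where b: "D = ?d + b" using D[OF v] le_iff_add by blast
    have "?s + ?d \<le> 4 * D" using sum_nbr_degrees_le[OF v] m' by linarith
    then have "?d * ?d + ?s + ?d \<le> ?d * ?d + 4 * D" by simp
    also have "\<dots> \<le> (D + 4) * ?d"
      unfolding b a by (simp add: algebra_simps)
    finally show ?thesis by (simp add: algebra_simps)
  qed
qed

text \<open>Here \<open>e\<close> is the number of edges of a graph, \<open>f\<close> the degree of one of its vertices and \<open>s\<close> the
  sum of the degrees of the neighbours of that vertex.\<close>

lemma hub_vector_arith:
  fixes n e f s :: nat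
  assumes n: "2 * e \<le> n" "e + 3 \<le> n" and f: "f \<le> e" and s: "s + f \<le> 2 * e"
    and s0: "f = 0 \<Longrightarrow> s = 0" and s1: "f = 1 \<Longrightarrow> s \<le> e"
  shows "2 * n * f + (n + 1) * (f * f + s) \<le> n * (n + 1) * f"
proof -
  \<comment> \<open>For \<open>f = 1\<close> and \<open>f = 2\<close> the slack comes from
    \<open>e + 3 \<le> n\<close>; from \<open>f = 3\<close> on it comes from
    \<open>2 * e \<le> n\<close>, which gives \<open>2 * f \<le> n\<close> and
    \<open>s + f \<le> n\<close>.\<close>
  consider "f = 0" | "f = 1" | "f = 2" | "3 \<le> f" by linarith
  then show ?thesis
  proof cases
    case 1 then show ?thesis using s0 by simp
  next
    case 2
    then obtain k where k: "n = s + 3 + k" using s1 n by (metis le_iff_add le_trans add_le_mono1)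
    show ?thesis unfolding k 2 by (simp add: algebra_simps)
  next
    case 3
    then have "s + 8 \<le> 2 * n" using s n by linarith
    then obtain k where k: "2 * n = s + 8 + k" using le_iff_add by blast
    have "(n + 1) * (2 * n) = (n + 1) * (s + 8 + k)" unfolding k ..
    then show ?thesis unfolding 3 by (simp add: algebra_simps)
  next
    case 4
    obtain a where a: "f = 3 + a" using 4 le_iff_add by blast
    obtain b where b: "n = 2 * f + b" using f n(1) by (metis le_iff_add le_trans mult_le_mono2)
    have sf: "s + f \<le> n" using s n by linarith
    have "2 * n * f + (n + 1) * (f * f + s) \<le> (n + 1) * (2 * f + (f * f + s))"
      by (simp add: algebra_simps)
    also have "\<dots> \<le> (n + 1) * (n * f)"
    proof (intro mult_left_mono)
      have "2 * f + (f * f + s) \<le> f + f * f + n" using sf by linarith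
      also have "\<dots> \<le> n * f" unfolding b a by (simp add: algebra_simps)
      finally show "2 * f + (f * f + s) \<le> n * f" .
    qed simp
    finally show ?thesis by (simp add: algebra_simps)
  qed
qed

text \<open>The degree vector can be too weak here by a term of order \<open>1 / d\<close>. The test vector \<open>y\<close> below satisfies
  the eigenvalue equation for \<open>d + 2\<close> exactly at the pendent neighbours of the hub.\<close>

lemma radius_le_hub_degree_plus_2:
  assumes G: "simple_graph G" and ni: "no_isolated_vertices G" and v: "v \<in> verts G"
    and d: "card (nbrs (edges G) v) = d" and m: "card (edges G) = d + e"
    and n1: "2 * e \<le> d + 1" and n2: "e + 3 \<le> d + 1"
  shows "signless_Laplacian_radius G \<le> real (d + 2)"
proof -
  let ?V = "verts G" and ?E = "edges G"
  interpret fin_graph ?V ?E using G by (rule simple_graph_imp_fin_graph)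
  define F where "F = {a \<in> ?E. v \<notin> a}"
  interpret F: fin_graph ?V F
    unfolding F_def by (rule fin_graph_subset) auto
  define n where "n = d + 1"
  define f where "f = (\<lambda>u. card (nbrs F u))"
  have cF: "card F = e" using m d card_edges_split[of v] by (simp add: F_def)
  have nF: "nbrs F u = nbrs ?E u - {v}" if "u \<noteq> v" for u
    using that by (auto simp: F_def nbrs_def)
  have sf: "(\<Sum>u\<in>?V. f u) = 2 * e" unfolding f_def using F.sum_degrees cF by simp
  have fle: "f u \<le> e" for u unfolding f_def using F.degree_le_card_E cF by simp
  \<comment> \<open>A pendent neighbour of the hub gets \<open>n\<close>, the hub
    \<open>n * n\<close>: there \<open>n + n * n = (n + 1) * n\<close> with
    \<open>n + 1 = d + 2\<close>. Each edge avoiding the hub adds \<open>n + 1\<close> at both of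
    its ends.\<close>
  define y where "y = (\<lambda>u. if u = v then n * n else (if u \<in> nbrs ?E v then n else 0) + (n + 1) * f u)"
  \<comment> \<open>What remains of the inequality at a neighbour \<open>u\<close> of the hub once
    \<open>y u + n * n\<close> is cancelled. It also covers vertices not adjacent to the
    hub.\<close>
  have key: "2 * n * f u + (n + 1) * (f u * f u + (\<Sum>w\<in>nbrs F u. f w)) \<le> n * (n + 1) * f u"
    if u: "u \<in> ?V" for u
  proof (rule hub_vector_arith)
    show "2 * e \<le> n" "e + 3 \<le> n" using n1 n2 by (auto simp: n_def)
    show "f u \<le> e" by (rule fle)
    show "(\<Sum>w\<in>nbrs F u. f w) + f u \<le> 2 * e"
      using F.sum_nbr_degrees_le[OF u] cF by (simp add: f_def)
    show "(\<Sum>w\<in>nbrs F u. f w) = 0" if "f u = 0"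
      using that F.finite_nbrs by (simp add: f_def)
    show "(\<Sum>w\<in>nbrs F u. f w) \<le> e" if "f u = 1"
    proof -
      obtain w where "nbrs F u = {w}" using \<open>f u = 1\<close> by (auto simp: f_def card_1_singleton_iff)
      then show ?thesis using fle by simp
    qed
  qed
  show ?thesis
  proof (rule signless_Laplacian_radius_le[OF G, of "\<lambda>u. real (y u)"])
    show "verts G \<noteq> {}" using v by blast
  next
    fix u assume u: "u \<in> verts G"
    have "f u > 0" if "u \<noteq> v" "u \<notin> nbrs ?E v"
    proof -
      have "nbrs F u = nbrs ?E u" using nF[OF that(1)] that(2) nbrs_sym by blast
      then show ?thesis using no_isolated_vertices_nbrs[OF G ni u] finite_nbrs
        by (simp add: f_def card_gt_0_iff)
    qed
    then show "0 < real (y u)" by (auto simp: y_def n_def)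
    have sl: "slap ?E (\<lambda>u. real (y u)) u = real (\<Sum>w\<in>nbrs ?E u. y u + y w)"
      by (simp add: slap_def)
    have "(\<Sum>w\<in>nbrs ?E u. y u + y w) \<le> (d + 2) * y u"
    proof (cases "u = v")
      case True
      have "(\<Sum>w\<in>nbrs ?E v. y v + y w) = (\<Sum>w\<in>nbrs ?E v. n * n + n + (n + 1) * f w)"
        using not_nbr_self[of v] by (intro sum.cong) (auto simp: y_def)
      also have "\<dots> = d * (n * n + n) + (n + 1) * (\<Sum>w\<in>nbrs ?E v. f w)"
        by (simp add: sum.distrib d sum_distrib_left distrib_left)
      \<comment> \<open>The hub leaves room for a sum of \<open>f\<close> up to \<open>n\<close>;
        the whole degree sum of \<open>F\<close> is \<open>2 * e\<close>, which is at most
        \<open>n\<close>.\<close>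
      also have "\<dots> \<le> d * (n * n + n) + (n + 1) * n"
      proof (intro add_left_mono mult_left_mono)
        have "(\<Sum>w\<in>nbrs ?E v. f w) \<le> 2 * e"
          unfolding sf[symmetric] using finite_V nbrs_subset[of v] by (intro sum_mono2) auto
        then show "(\<Sum>w\<in>nbrs ?E v. f w) \<le> n" using n1 by (simp add: n_def)
      qed simp
      also have "d * (n * n + n) + (n + 1) * n = (d + 2) * y v"
        by (simp add: y_def n_def algebra_simps)
      finally show ?thesis using True by simp
    next
      case False
      \<comment> \<open>Every \<open>w\<close> is charged the extra \<open>n\<close> as if it were
        adjacent to the hub.\<close>
      have "(\<Sum>w\<in>nbrs F u. y u + y w) \<le> (\<Sum>w\<in>nbrs F u. y u + n + (n + 1) * f w)"
        using nF[OF False] by (intro sum_mono) (auto simp: y_def)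
      also have "\<dots> = f u * (y u + n) + (n + 1) * (\<Sum>w\<in>nbrs F u. f w)"
        by (simp add: sum.distrib f_def sum_distrib_left distrib_left)
      finally have *: "(\<Sum>w\<in>nbrs F u. y u + y w) \<le> f u * (y u + n) + (n + 1) * (\<Sum>w\<in>nbrs F u. f w)" .
      show ?thesis
      proof (cases "u \<in> nbrs ?E v")
        case True
        then have "v \<in> nbrs ?E u" using nbrs_sym by blast
        then have "(\<Sum>w\<in>nbrs ?E u. y u + y w) = y u + n * n + (\<Sum>w\<in>nbrs F u. y u + y w)"
          unfolding nF[OF False] using finite_nbrs by (simp add: sum.remove y_def)
        also have "\<dots> \<le> y u + n * n + (f u * (y u + n) + (n + 1) * (\<Sum>w\<in>nbrs F u. f w))"
          using * by simp
        also have "\<dots> = y u + n * n + (2 * n * f u + (n + 1) * (f u * f u + (\<Sum>w\<in>nbrs F u. f w)))"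
          using True False by (simp add: y_def algebra_simps)
        also have "\<dots> \<le> y u + n * n + n * (n + 1) * f u" using key[OF u] by simp
        also have "\<dots> = (d + 2) * y u"
          using True False by (simp add: y_def n_def algebra_simps)
        finally show ?thesis .
      next
        case nb: False
        then have "nbrs ?E u = nbrs F u" using nF[OF False] nbrs_sym by blast
        then have "(\<Sum>w\<in>nbrs ?E u. y u + y w) \<le> f u * (y u + n) + (n + 1) * (\<Sum>w\<in>nbrs F u. f w)"
          using * by simp
        also have "\<dots> \<le> 2 * n * f u + (n + 1) * (f u * f u + (\<Sum>w\<in>nbrs F u. f w))"
          using nb False by (simp add: y_def algebra_simps)
        also have "\<dots> \<le> n * (n + 1) * f u" by (rule key[OF u])
        also have "\<dots> \<le> (d + 2) * y u"
          using nb False by (simp add: y_def n_def algebra_simps)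
        finally show ?thesis .
      qed
    qed
    then show "slap ?E (\<lambda>u. real (y u)) u \<le> real (d + 2) * real (y u)"
      unfolding sl of_nat_mult[symmetric] of_nat_le_iff .
  qed
qed

section \<open>Cycle lengths, and the exceptional case \<open>m = 5\<close>,
  \<open>c = 3\<close>\<close>

lemma finite_cycle_lengths:
  assumes "finite (verts G)"
  shows "finite {length p | p. is_cycle G p}"
proof (rule finite_subset)
  show "{length p | p. is_cycle G p} \<subseteq> {..card (verts G)}"
    using card_mono[OF assms] by (auto simp: is_cycle_def) (metis distinct_card)
qed simp

lemma cycle_length_le_circumference:
  assumes "finite (verts G)" "is_cycle G p"
  shows "length p \<le> circumference G"
  unfolding circumference_def using finite_cycle_lengths[OF assms(1)] assms(2)
  by (intro Max_ge) auto

lemma circumference_attained: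
  assumes "finite (verts G)" "circumference G > 0"
  obtains p where "is_cycle G p" "length p = circumference G"
proof -
  have "circumference G \<in> insert 0 {length p | p. is_cycle G p}"
    unfolding circumference_def using finite_cycle_lengths[OF assms(1)] by (intro Max_in) auto
  then show thesis using assms(2) that by auto
qed

text \<open>The degree vector works if the neighbour degrees at each vertex of degree 3 sum to at
  most 6. Otherwise the two edges avoiding such a vertex lie inside its neighbourhood, share an end
  there, and close a 4-cycle with it.\<close>

lemma radius_le_5:
  assumes G: "simple_graph G" and ni: "no_isolated_vertices G" and ne: "verts G \<noteq> {}"
    and m: "card (edges G) = 5" and circ: "circumference G \<le> 3"
    and D: "\<And>v. v \<in> verts G \<Longrightarrow> card (nbrs (edges G) v) \<le> 3"
  shows "signless_Laplacian_radius G \<le> 5"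
proof -
  let ?V = "verts G" and ?E = "edges G"
  interpret fin_graph ?V ?E using G by (rule simple_graph_imp_fin_graph)
  have "(\<Sum>w\<in>nbrs ?E v. card (nbrs ?E w)) \<le> 6"
    if v: "v \<in> ?V" and d: "card (nbrs ?E v) = 3" for v
  proof (rule ccontr)
    assume *: "\<not> ?thesis"
    define F where "F = {a \<in> ?E. v \<notin> a}"
    interpret F: fin_graph ?V F
    unfolding F_def by (rule fin_graph_subset) auto
    have cF: "card F = 2" using m d card_edges_split[of v] by (simp add: F_def)
    have deg: "card (nbrs ?E w) = 1 + card (nbrs F w)" if w: "w \<in> nbrs ?E v" for w
    proof -
      have "w \<noteq> v" using w not_nbr_self by blast
      then have "nbrs F w = nbrs ?E w - {v}" by (auto simp: F_def nbrs_def)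
      moreover have "v \<in> nbrs ?E w" using w nbrs_sym by blast
      ultimately show ?thesis using finite_nbrs card.remove by fastforce
    qed
    have "(\<Sum>w\<in>nbrs ?E v. card (nbrs ?E w)) = 3 + (\<Sum>w\<in>nbrs ?E v. card (nbrs F w))"
      using d by (simp add: deg sum.distrib del: One_nat_def plus_1_eq_Suc cong: sum.cong)
    \<comment> \<open>The edges to \<open>v\<close> account for 3 of a sum of at least 7. The other
      4 exhaust the degree sum of the two edges of \<open>F\<close>, so no end of them lies outside
      the neighbourhood.\<close>
    then have ge: "4 \<le> (\<Sum>w\<in>nbrs ?E v. card (nbrs F w))" using * by linarith
    have "(\<Sum>w\<in>?V. card (nbrs F w)) = 4" using F.sum_degrees cF by simp
    moreover have "(\<Sum>w\<in>?V. card (nbrs F w))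
        = (\<Sum>w\<in>?V - nbrs ?E v. card (nbrs F w)) + (\<Sum>w\<in>nbrs ?E v. card (nbrs F w))"
      by (rule sum.subset_diff[OF nbrs_subset finite_V])
    ultimately have "(\<Sum>w\<in>?V - nbrs ?E v. card (nbrs F w)) = 0" using ge by linarith
    then have out: "nbrs F w = {}" if "w \<in> ?V" "w \<notin> nbrs ?E v" for w
      using that finite_V F.finite_nbrs by simp
    have sub: "a \<subseteq> nbrs ?E v" if a: "a \<in> F" for a
    proof
      fix w assume w: "w \<in> a"
      then have "nbrs F w \<noteq> {}" using F.edge_through[OF a w] by blast
      then show "w \<in> nbrs ?E v" using out F.edge_subset[OF a] w by blast
    qed
    obtain e1 e2 where e12: "F = {e1, e2}" "e1 \<noteq> e2" using cF by (auto simp: card_2_iff)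
    have c12: "card e1 = 2" "card e2 = 2" using e12 F.card_edge by auto
    have "e1 \<inter> e2 \<noteq> {}"
    proof
      assume "e1 \<inter> e2 = {}"
      then have "card (e1 \<union> e2) = 4" using c12 by (subst card_Un_disjoint) (auto intro: card_ge_0_finite)
      moreover have "card (e1 \<union> e2) \<le> 3" using sub e12 finite_nbrs unfolding d[symmetric] by (intro card_mono) auto
      ultimately show False by simp
    qed
    then obtain b where b: "b \<in> e1" "b \<in> e2" by blast
    obtain a where a: "e1 = {b, a}" "b \<noteq> a" using F.edge_through[of e1 b] e12 b by blast
    obtain c where c: "e2 = {b, c}" "b \<noteq> c" using F.edge_through[of e2 b] e12 b by blast
    have ac: "a \<noteq> c" using a c e12 by blast
    have N: "a \<in> nbrs ?E v" "b \<in> nbrs ?E v" "c \<in> nbrs ?E v" using sub e12 a c by auto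
    have "{b, a} \<in> ?E" "{b, c} \<in> ?E" using e12 a c by (auto simp: F_def)
    then have E: "{v, a} \<in> ?E" "{a, b} \<in> ?E" "{b, c} \<in> ?E" "{c, v} \<in> ?E"
      using N by (auto simp: nbrs_def insert_commute)
    have "v \<noteq> a" "v \<noteq> b" "v \<noteq> c" using N not_nbr_self by blast+
    then have "distinct [v, a, b, c]" using a c ac by auto
    moreover have "set [v, a, b, c] \<subseteq> ?V" using N nbrs_subset[of v] v by auto
    moreover have "{[v, a, b, c] ! i, [v, a, b, c] ! (Suc i mod 4)} \<in> ?E" if i4: "i < 4" for i
    proof -
      consider "i = 0" | "i = 1" | "i = 2" | "i = 3" using i4 by linarith
      then show ?thesis by cases (use E in simp_all)
    qed
    ultimately have "is_cycle G [v, a, b, c]" unfolding is_cycle_def by simp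
    from cycle_length_le_circumference[OF finite_V this] circ show False by simp
  qed
  then have three: "card (nbrs ?E v) = 3 \<Longrightarrow> v \<in> ?V \<Longrightarrow> (\<Sum>w\<in>nbrs ?E v. card (nbrs ?E w)) \<le> 6" for v
    by blast
  have "signless_Laplacian_radius G \<le> real 5"
  proof (rule radius_le_of_degree_vector[OF G ni ne])
    fix v assume v: "v \<in> ?V"
    let ?d = "card (nbrs ?E v)" and ?s = "\<Sum>w\<in>nbrs ?E v. card (nbrs ?E w)"
    have "?s \<le> (\<Sum>w\<in>nbrs ?E v. 3)" using D nbrs_subset[of v] by (intro sum_mono) blast
    then have s: "?s \<le> 3 * ?d" by simp
    have "?d = 0 \<or> ?d = 1 \<or> ?d = 2 \<or> ?d = 3" using D[OF v] by linarith
    then show "?d * ?d + ?s \<le> 5 * ?d" using s three[OF _ v] by auto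
  qed
  then show ?thesis by simp
qed

section \<open>Graphs with a hub of maximal degree\<close>

text \<open>A star at \<open>p 0\<close> with leaf set \<open>N\<close>, and a path on
  \<open>p 1\<close>, ..., \<open>p (c - 1)\<close>. Path vertices may belong to \<open>N\<close>:
  the edges from the hub to the two path ends close the cycle, those to inner path vertices are
  chords.\<close>

definition hub_path :: "'a set \<Rightarrow> (nat \<Rightarrow> 'a) \<Rightarrow> nat \<Rightarrow> 'a set set" where
  "hub_path N p c = (\<lambda>u. {p 0, u}) ` N \<union> (\<lambda>i. {p i, p (Suc i)}) ` {1..<c - 1}"

lemma inj_on_path_edges:
  assumes "inj_on p {..<c}"
  shows "inj_on (\<lambda>i. {p i, p (Suc i)}) {..<c - 1}"
proof (rule inj_onI)
  fix i j assume ij: "i \<in> {..<c - 1}" "j \<in> {..<c - 1}" "{p i, p (Suc i)} = {p j, p (Suc j)}"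
  have eq: "a = b" if "p a = p b" "a < c" "b < c" for a b
    using assms that by (auto simp: inj_on_def)
  have lt: "i < c" "j < c" "Suc i < c" "Suc j < c" using ij by auto
  from ij(3) consider "p i = p j" | "p i = p (Suc j)" "p (Suc i) = p j"
    by (auto simp: doubleton_eq_iff)
  then show "i = j"
  proof cases
    case 1
    then show ?thesis using eq lt by blast
  next
    case 2
    have "i = Suc j" "Suc i = j" using eq[OF 2(1)] eq[OF 2(2)] lt by auto
    then show ?thesis by simp
  qed
qed

lemma qform_hub_path:
  fixes x :: "'a \<Rightarrow> real"
  assumes inj: "inj_on p {..<c}" and N: "finite N" "p 0 \<notin> N"
  shows "qform (hub_path N p c) x
    = (\<Sum>u\<in>N. (x (p 0) + x u)\<^sup>2) + (\<Sum>i=1..<c-1. (x (p i) + x (p (Suc i)))\<^sup>2)"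
proof -
  have pne: "p i \<noteq> p j" if "i \<noteq> j" "i < c" "j < c" for i j
    using inj that by (auto simp: inj_on_def)
  have inj1: "inj_on (\<lambda>u. {p 0, u}) N" by (auto simp: inj_on_def doubleton_eq_iff)
  have inj2: "inj_on (\<lambda>i. {p i, p (Suc i)}) {1..<c - 1}"
    by (rule inj_on_subset[OF inj_on_path_edges[OF inj]]) auto
  have "p 0 \<notin> {p i, p (Suc i)}" if i: "i \<in> {1..<c - 1}" for i
  proof -
    have "i \<noteq> 0" "i < c" "Suc i < c" using i by auto
    then show ?thesis using pne[of 0 i] pne[of 0 "Suc i"] by simp
  qed
  then have "(\<lambda>u. {p 0, u}) ` N \<inter> (\<lambda>i. {p i, p (Suc i)}) ` {1..<c - 1} = {}" by fastforce
  then have "qform (hub_path N p c) x = (\<Sum>u\<in>N. (sum x {p 0, u})\<^sup>2)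
      + (\<Sum>i=1..<c-1. (sum x {p i, p (Suc i)})\<^sup>2)"
    unfolding qform_def hub_path_def using N
    by (simp add: sum.union_disjoint sum.reindex[OF inj1] sum.reindex[OF inj2] del: One_nat_def)
  moreover have "sum x {p 0, u} = x (p 0) + x u" if "u \<in> N" for u
  proof -
    have "p 0 \<noteq> u" using that N by blast
    then show ?thesis by simp
  qed
  moreover have "sum x {p i, p (Suc i)} = x (p i) + x (p (Suc i))" if i: "i \<in> {1..<c - 1}" for i
  proof -
    have "i < c" "Suc i < c" using i by auto
    then show ?thesis using pne[of i "Suc i"] by simp
  qed
  ultimately show ?thesis by simp
qed

section \<open>The extremal graph as a hub with a path, and a lower bound for its radius\<close>

lemma verts_extremal_graph:
  assumes "2 * c \<le> m + 3"
  shows "verts (extremal_graph m c) = {0..<m + 3 - c}"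
  using assms by (simp add: extremal_graph_def)

text \<open>The two cycle edges at 0, the chords and the pendent edges together form the star at 0;
  the other cycle edges form the path.\<close>

lemma edges_extremal_graph:
  assumes "3 \<le> c" "2 * c \<le> m + 3"
  shows "edges (extremal_graph m c) = hub_path {1..<m + 3 - c} (\<lambda>i. i) c"
proof (intro equalityI subsetI)
  fix e assume "e \<in> edges (extremal_graph m c)"
  then consider i where "e = {i, Suc i mod c}" "i < c" | i where "e = {0, i}" "2 \<le> i" "i \<le> c - 2"
    | j where "e = {0, c + j}" "j < m + 3 - 2 * c"
    by (auto simp: extremal_graph_def)
  then show "e \<in> hub_path {1..<m + 3 - c} (\<lambda>i. i) c"
  proof cases
    case 1
    consider "i = 0" | "i = c - 1" "i \<noteq> 0" | "1 \<le> i" "i < c - 1" using 1(2) by linarith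
    then show ?thesis
    proof cases
      case a: 1
      then have "e = {0, 1}" using 1 assms by simp
      then show ?thesis using assms by (auto simp: hub_path_def)
    next
      case a: 2
      then have "e = {0, c - 1}" using 1 assms by (simp add: insert_commute)
      moreover have "c - 1 \<in> {1..<m + 3 - c}" using assms by auto
      ultimately show ?thesis by (auto simp: hub_path_def)
    next
      case a: 3
      then have "e = {i, Suc i}" using 1 by simp
      moreover have "i \<in> {1..<c - 1}" using a by auto
      ultimately show ?thesis by (auto simp: hub_path_def)
    qed
  next
    case 2
    then have "i \<in> {1..<m + 3 - c}" using assms by auto
    then show ?thesis using 2 by (auto simp: hub_path_def)
  next
    case 3
    then have "c + j \<in> {1..<m + 3 - c}" using assms by auto
    then show ?thesis using 3 by (auto simp: hub_path_def)
  qed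
next
  fix e assume "e \<in> hub_path {1..<m + 3 - c} (\<lambda>i. i) c"
  then consider i where "e = {0, i}" "1 \<le> i" "i < m + 3 - c"
    | i where "e = {i, Suc i}" "1 \<le> i" "i < c - 1"
    by (auto simp: hub_path_def)
  then show "e \<in> edges (extremal_graph m c)"
  proof cases
    case 1
    consider "i = 1" | "2 \<le> i" "i \<le> c - 2" | "i = c - 1" | "c \<le> i" using 1 by linarith
    then show ?thesis
    proof cases
      case a: 1
      have "e = {0, Suc 0 mod c}" "0 < c" using 1 a assms by auto
      then show ?thesis by (auto simp: extremal_graph_def)
    next
      case a: 2
      then show ?thesis using 1 by (auto simp: extremal_graph_def)
    next
      case a: 3
      then have "e = {c - 1, Suc (c - 1) mod c}" "c - 1 < c" using 1 assms by (auto simp: insert_commute)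
      then show ?thesis unfolding extremal_graph_def by auto
    next
      case a: 4
      then have "e = {0, c + (i - c)}" "i - c < m + 3 - 2 * c" using 1 by auto
      then show ?thesis unfolding extremal_graph_def by auto
    qed
  next
    case 2
    then have "e = {i, Suc i mod c}" "i < c" by auto
    then show ?thesis unfolding extremal_graph_def by auto
  qed
qed

lemma simple_graph_extremal:
  assumes "3 \<le> c" "2 * c \<le> m + 3"
  shows "simple_graph (extremal_graph m c)"
  unfolding simple_graph_def verts_extremal_graph[OF assms(2)] edges_extremal_graph[OF assms]
  using assms by (auto simp: hub_path_def)

lemma extremal_graph_Rayleigh:
  fixes z :: "nat \<Rightarrow> real"
  assumes "3 \<le> c" "2 * c \<le> m + 3"
  shows "(\<Sum>i=1..<m+3-c. (z 0 + z i)\<^sup>2) + (\<Sum>i=1..<c-1. (z i + z (Suc i))\<^sup>2)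
    \<le> signless_Laplacian_radius (extremal_graph m c) * (\<Sum>i=0..<m+3-c. (z i)\<^sup>2)"
proof -
  have "verts (extremal_graph m c) \<noteq> {}"
    unfolding verts_extremal_graph[OF assms(2)] using assms by auto
  from signless_Laplacian_radius[OF simple_graph_extremal[OF assms] this]
  have "qform (edges (extremal_graph m c)) z
    \<le> signless_Laplacian_radius (extremal_graph m c) * (\<Sum>v\<in>verts (extremal_graph m c). (z v)\<^sup>2)"
    by metis
  then show ?thesis
    unfolding verts_extremal_graph[OF assms(2)] edges_extremal_graph[OF assms]
    by (subst (asm) qform_hub_path) auto
qed

text \<open>The star at the hub alone has radius \<open>d + 1\<close>, where
  \<open>d = m + 2 - c\<close>; the path edges make the inequality strict.\<close>

lemma extremal_graph_radius_gt:
  assumes "3 \<le> c" "2 * c \<le> m + 3"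
  shows "real (m + 3 - c) < signless_Laplacian_radius (extremal_graph m c)"
proof -
  define d where "d = m + 2 - c"
  have d: "m + 3 - c = Suc d" "0 < d" using assms by (auto simp: d_def)
  \<comment> \<open>The principal eigenvector of the star with \<open>d\<close> leaves. Each of the
    \<open>c - 2\<close> path edges adds 4 to the form.\<close>
  let ?z = "\<lambda>i::nat. if i = 0 then real d else 1"
  let ?q = "signless_Laplacian_radius (extremal_graph m c)"
  have "(\<Sum>i=1..<Suc d. (?z 0 + ?z i)\<^sup>2) = real d * (real d + 1)\<^sup>2" by simp
  moreover have "(\<Sum>i=1..<c-1. (?z i + ?z (Suc i))\<^sup>2) = real (c - 2) * 4" by simp
  moreover have "(\<Sum>i=0..<Suc d. (?z i)\<^sup>2) = real d * (real d + 1)"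
    by (simp add: sum.atLeast_Suc_lessThan power2_eq_square algebra_simps)
  ultimately have "real d * (real d + 1)\<^sup>2 + real (c - 2) * 4 \<le> ?q * (real d * (real d + 1))"
    using extremal_graph_Rayleigh[OF assms, of ?z] unfolding d by simp
  moreover have "0 < real (c - 2) * 4" using assms by simp
  ultimately have "(real d + 1) * (real d * (real d + 1)) < ?q * (real d * (real d + 1))"
    by (simp add: power2_eq_square algebra_simps)
  then have "real d + 1 < ?q" using d by (simp add: mult_less_cancel_right)
  then show ?thesis using d by simp
qed

section \<open>Structure forced by a vertex of degree at least \<open>m - c + 2\<close>\<close>

lemma is_cycle_rotate:
  assumes "is_cycle G p"
  shows "is_cycle G (rotate k p)"
proof -
  let ?n = "length p"
  have n: "?n > 0" using assms by (auto simp: is_cycle_def)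
  have "{rotate k p ! i, rotate k p ! (Suc i mod ?n)} \<in> edges G" if i: "i < ?n" for i
  proof -
    have "rotate k p ! i = p ! ((k + i) mod ?n)" using i by (rule nth_rotate)
    moreover have "rotate k p ! (Suc i mod ?n) = p ! (Suc ((k + i) mod ?n) mod ?n)"
      using n by (simp add: nth_rotate mod_simps)
    ultimately show ?thesis using assms n by (auto simp: is_cycle_def)
  qed
  then show ?thesis using assms by (auto simp: is_cycle_def)
qed

text \<open>At most \<open>c - 2\<close> edges avoid \<open>v\<close>. A longest cycle must
  therefore pass through \<open>v\<close>, and its \<open>c - 2\<close> edges not at
  \<open>v\<close> are then all the edges that avoid \<open>v\<close>.\<close>

lemma hub_structure:
  assumes G: "simple_graph G" and circ: "circumference G = c" and c: "3 \<le> c"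
    and m: "card (edges G) \<le> card (nbrs (edges G) v) + (c - 2)"
  obtains p where "p 0 = v" "inj_on p {..<c}" "p ` {..<c} \<subseteq> verts G"
    "edges G = hub_path (nbrs (edges G) v) p c"
    "\<And>i. Suc i < c \<Longrightarrow> {p i, p (Suc i)} \<in> edges G"
    "card (edges G) = card (nbrs (edges G) v) + (c - 2)"
proof -
  let ?V = "verts G" and ?E = "edges G"
  interpret fin_graph ?V ?E using G by (rule simple_graph_imp_fin_graph)
  define F where "F = {a \<in> ?E. v \<notin> a}"
  have fF: "finite F" using finite_E by (simp add: F_def)
  have split: "card ?E = card (nbrs ?E v) + card F"
    unfolding F_def by (rule card_edges_split)
  then have cF: "card F \<le> c - 2" using m by linarith
  obtain q where q: "is_cycle G q" "length q = c"
    using circumference_attained[OF finite_V] circ c by (metis gr0I not_numeral_le_zero)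
  have step: "{r ! i, r ! (Suc i)} \<in> ?E" if "is_cycle G r" "length r = c" "Suc i < c" for r i
  proof -
    have "{r ! i, r ! (Suc i mod c)} \<in> ?E" using that Suc_lessD unfolding is_cycle_def by blast
    then show ?thesis using that(3) by simp
  qed
  have inj: "inj_on ((!) r) {..<c}" if "is_cycle G r" "length r = c" for r
    using that by (intro inj_on_nth) (auto simp: is_cycle_def)
  have "v \<in> set q"
  proof (rule ccontr)
    assume v: "v \<notin> set q"
    \<comment> \<open>The \<open>c - 1\<close> edges of the cycle other than its closing edge
      already exceed the bound \<open>c - 2\<close>.\<close>
    have "(\<lambda>i. {q ! i, q ! (Suc i)}) ` {..<c - 1} \<subseteq> F"
    proof (rule image_subsetI)
      fix i assume "i \<in> {..<c - 1}"
      then have i: "Suc i < c" by auto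
      then have "q ! i \<in> set q" "q ! Suc i \<in> set q" using q(2) by auto
      then show "{q ! i, q ! (Suc i)} \<in> F" using step[OF q i] v by (auto simp: F_def)
    qed
    then have "card ((\<lambda>i. {q ! i, q ! (Suc i)}) ` {..<c - 1}) \<le> card F"
      by (rule card_mono[OF fF])
    then have "c - 1 \<le> card F"
      unfolding card_image[OF inj_on_path_edges[OF inj[OF q]]] by simp
    then show False using cF c by linarith
  qed
  then obtain k where k: "k < c" "q ! k = v" using q(2) by (metis in_set_conv_nth)
  \<comment> \<open>Rotating the cycle puts \<open>v\<close> at index 0, so the edges avoiding
    \<open>v\<close> are those starting at an index in \<open>{1..<c - 1}\<close>.\<close>
  define r where "r = rotate k q"
  have r: "is_cycle G r" "length r = c" using q by (auto simp: r_def is_cycle_rotate)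
  have r0: "r ! 0 = v" using k q(2) by (simp add: r_def nth_rotate)
  let ?P = "(\<lambda>i. {r ! i, r ! (Suc i)}) ` {1..<c - 1}"
  have "?P \<subseteq> F"
  proof (rule image_subsetI)
    fix i assume "i \<in> {1..<c - 1}"
    then have i: "Suc i < c" "0 < i" by auto
    have "r ! j \<noteq> v" if "0 < j" "j < c" for j
      using inj[OF r] r0 that by (metis inj_on_eq_iff lessThan_iff less_trans neq0_conv)
    then have "r ! i \<noteq> v" "r ! Suc i \<noteq> v" using i by auto
    then show "{r ! i, r ! (Suc i)} \<in> F" using step[OF r i(1)] by (auto simp: F_def)
  qed
  moreover have "card ?P = c - 2"
    by (subst card_image) (auto intro: inj_on_subset[OF inj_on_path_edges[OF inj[OF r]]])
  ultimately have FP: "F = ?P" using card_subset_eq[OF fF] card_mono[OF fF] cF by (metis le_antisym)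
  have "?E = {a \<in> ?E. v \<in> a} \<union> F" by (auto simp: F_def)
  then have "?E = hub_path (nbrs ?E v) ((!) r) c"
    unfolding hub_path_def r0 FP incident_eq_image .
  moreover have "(!) r ` {..<c} \<subseteq> ?V" using r by (auto simp: is_cycle_def)
  ultimately show thesis
    using that[of "(!) r"] r0 inj[OF r] step[OF r] split FP \<open>card ?P = c - 2\<close> by simp
qed

section \<open>Comparison of such a graph with the extremal graph\<close>

lemma (in fin_graph) eigenvector_zero_nbr:
  assumes "\<And>v. 0 \<le> x v" "slap E x u = q * x u" "x u = 0" "w \<in> nbrs E u"
  shows "x w = 0"
proof -
  have "(\<Sum>w\<in>nbrs E u. x w) = 0" using assms(2,3) by (simp add: slap_def)
  then show ?thesis using assms(1,4) finite_nbrs by (simp add: sum_nonneg_eq_0_iff)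
qed

lemma hub_path_nbrs_pendant:
  assumes "w \<notin> p ` {..<c}" "w \<in> N" "0 < c"
  shows "nbrs (hub_path N p c) w = {p 0}"
proof -
  have "u = p 0" if u: "{w, u} \<in> hub_path N p c" for u
  proof -
    have w: "w \<noteq> p i" if "i < c" for i using assms(1) that by blast
    have "{w, u} \<noteq> {p i, p (Suc i)}" if i: "i \<in> {1..<c - 1}" for i
    proof -
      have "i < c" "Suc i < c" using i by auto
      then show ?thesis using w[of i] w[of "Suc i"] by (auto simp: doubleton_eq_iff)
    qed
    then have "{w, u} \<in> (\<lambda>u. {p 0, u}) ` N" using u unfolding hub_path_def by blast
    then show ?thesis using w[OF assms(3)] by (auto simp: doubleton_eq_iff)
  qed
  moreover have "{w, p 0} \<in> hub_path N p c"
    using assms(2) by (auto simp: hub_path_def insert_commute)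
  ultimately show ?thesis unfolding nbrs_def by blast
qed

lemma hub_path_vertices:
  assumes G: "simple_graph G" and ni: "no_isolated_vertices G"
    and p: "p ` {..<c} \<subseteq> verts G" and c: "3 \<le> c"
    and E: "edges G = hub_path (nbrs (edges G) (p 0)) p c"
  shows "verts G = p ` {..<c} \<union> nbrs (edges G) (p 0)"
proof
  interpret fin_graph "verts G" "edges G" using G by (rule simple_graph_imp_fin_graph)
  show "verts G \<subseteq> p ` {..<c} \<union> nbrs (edges G) (p 0)"
  proof
    fix w assume "w \<in> verts G"
    then obtain e where "e \<in> edges G" "w \<in> e" using ni by (auto simp: no_isolated_vertices_def)
    then have "e \<in> hub_path (nbrs (edges G) (p 0)) p c" "w \<in> e" using E by auto
    then consider "w \<in> {p 0} \<union> nbrs (edges G) (p 0)"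
      | i where "i \<in> {1..<c - 1}" "w \<in> {p i, p (Suc i)}"
      unfolding hub_path_def by blast
    then show "w \<in> p ` {..<c} \<union> nbrs (edges G) (p 0)"
    proof cases
      case 1
      then show ?thesis using c by auto
    next
      case 2
      then have "i < c" "Suc i < c" by auto
      then show ?thesis using 2(2) by auto
    qed
  qed
  show "p ` {..<c} \<union> nbrs (edges G) (p 0) \<subseteq> verts G" using p nbrs_subset by blast
qed

text \<open>A chord missing at \<open>p i\<close> is compensated by identifying \<open>p i\<close> with a pendent vertex and giving
  the new vertex the larger of the two values: the quadratic form does not decrease, and the norm
  loses the square of the smaller value.\<close>

lemma radius_less_of_missing_chord:
  assumes G: "simple_graph G" and ni: "no_isolated_vertices G"
    and p: "inj_on p {..<c}" "p ` {..<c} \<subseteq> verts G" and c: "3 \<le> c" "2 * c \<le> m + 3"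
    and E: "edges G = hub_path (nbrs (edges G) (p 0)) p c"
    and step: "\<And>i. Suc i < c \<Longrightarrow> {p i, p (Suc i)} \<in> edges G"
    and d: "card (nbrs (edges G) (p 0)) = m + 2 - c"
    and j: "j \<in> {1..<c}" "p j \<notin> nbrs (edges G) (p 0)"
  shows "signless_Laplacian_radius G < signless_Laplacian_radius (extremal_graph m c)"
proof -
  let ?V = "verts G" and ?E = "edges G" and ?q = "signless_Laplacian_radius G"
    and ?q' = "signless_Laplacian_radius (extremal_graph m c)"
  interpret fin_graph ?V ?E using G by (rule simple_graph_imp_fin_graph)
  define N where "N = nbrs ?E (p 0)"
  define M where "M = m + 3 - c"
  have fN: "finite N" and v: "p 0 \<notin> N" using finite_nbrs not_nbr_self by (auto simp: N_def)
  have V: "?V = p ` {..<c} \<union> N" unfolding N_def by (rule hub_path_vertices[OF G ni p(2) c(1) E])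
  \<comment> \<open>\<open>W\<close> holds the pendent neighbours of the hub; \<open>S\<close> and
    \<open>T\<close> index the path vertices joined and not joined to it.\<close>
  define W where "W = N - p ` {..<c}"
  define S where "S = {i \<in> {1..<c}. p i \<in> N}"
  define T where "T = {i \<in> {1..<c}. p i \<notin> N}"
  have ST: "{1..<c} = S \<union> T" "S \<inter> T = {}" "finite S" "finite T" by (auto simp: S_def T_def)
  have injS: "inj_on p S" by (rule inj_on_subset[OF p(1)]) (auto simp: S_def)
  have NSW: "N = p ` S \<union> W" "p ` S \<inter> W = {}"
  proof -
    show "p ` S \<inter> W = {}" by (auto simp: S_def W_def)
    have "u \<in> p ` S" if u: "u \<in> N" "u \<in> p ` {..<c}" for u
    proof -
      obtain i where i: "u = p i" "i < c" using u by auto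
      moreover have "i \<noteq> 0" using i u v by metis
      ultimately show ?thesis using u by (auto simp: S_def)
    qed
    then show "N = p ` S \<union> W" by (auto simp: S_def W_def)
  qed
  have fW: "finite W" using fN by (simp add: W_def)
  have "card S + card W = card N"
    unfolding NSW(1) using ST NSW(2) fW by (simp add: card_Un_disjoint card_image[OF injS])
  moreover have "card S + card T = c - 1"
    using card_Un_disjoint[OF ST(3,4,2)] ST(1) by (metis card_atLeastLessThan)
  \<comment> \<open>\<open>M\<close> is the order of the extremal graph, which has
    \<open>M - c\<close> pendent vertices. The hub degrees agree, so each missing edge from the hub
    to the path is matched by one surplus pendent vertex.\<close>
  ultimately have cW: "card W = card T + (M - c)" using d c by (auto simp: M_def N_def)
  have Tj: "j \<in> T" using j by (auto simp: T_def N_def)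
  then have cT: "0 < card T" using ST(4) by (auto simp: card_gt_0_iff)

  obtain x where x: "\<And>v. 0 \<le> x v" "(\<Sum>v\<in>?V. (x v)\<^sup>2) = 1"
    "\<And>v. v \<in> ?V \<Longrightarrow> slap ?E x v = ?q * x v"
    "\<And>y. qform ?E y \<le> ?q * (\<Sum>v\<in>?V. (y v)\<^sup>2)"
    using signless_Laplacian_radius[OF G] c p(2)
    by (metis all_not_in_conv image_subset_iff lessThan_iff less_le_trans zero_less_numeral)
  have pV: "p i \<in> ?V" if "i < c" for i using p(2) that by blast
  \<comment> \<open>A zero of a nonnegative eigenvector spreads to all neighbours. From the hub it
    would reach the path and all of \<open>N\<close>, hence every vertex.\<close>
  have hub_pos: "0 < x (p 0)"
  proof (rule ccontr)
    assume "\<not> ?thesis"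
    then have x0: "x (p 0) = 0" using x(1)[of "p 0"] by linarith
    have "x (p i) = 0" if "i < c" for i
      using that
    proof (induction i)
      case (Suc i)
      then show ?case
        using eigenvector_zero_nbr[OF x(1) x(3)[OF pV], of i "p (Suc i)"] step[of i]
        by (simp add: nbrs_def)
    qed (use x0 in simp)
    moreover have "x w = 0" if "w \<in> N" for w
      using eigenvector_zero_nbr[OF x(1) x(3)[OF pV] x0] that c by (simp add: N_def)
    ultimately have "x w = 0" if "w \<in> ?V" for w using that V by auto
    then show False using x(2) by simp
  qed
  have path_pos: "0 < x (p i)" if "i < c" for i
    using that
  proof (induction i)
    case (Suc i)
    have "x (p (Suc i)) \<noteq> 0"
    proof
      assume 0: "x (p (Suc i)) = 0"
      have "p i \<in> nbrs ?E (p (Suc i))" using step[OF Suc.prems] by (simp add: nbrs_def insert_commute)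
      from eigenvector_zero_nbr[OF x(1) x(3)[OF pV[OF Suc.prems]] 0 this] Suc show False by simp
    qed
    then show ?case using x(1)[of "p (Suc i)"] by linarith
  qed (use hub_pos in simp)
  \<comment> \<open>The eigenvalue equation at a pendent vertex determines its value from the hub,
    so all pendent vertices share one value \<open>t\<close>.\<close>
  have pend: "(?q - 1) * x w = x (p 0)" if w: "w \<in> W" for w
  proof -
    have "nbrs ?E w = {p 0}"
      using hub_path_nbrs_pendant[of w p c N] w c E by (simp add: W_def N_def)
    moreover have "w \<in> ?V" using w V by (auto simp: W_def)
    ultimately show ?thesis using x(3)[of w] by (simp add: slap_def algebra_simps)
  qed
  obtain w0 where w0: "w0 \<in> W" using cW cT by (metis add_gr_0 card_gt_0_iff ex_in_conv)
  define t where "t = x w0"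
  have q1: "?q - 1 \<noteq> 0" using pend[OF w0] hub_pos by auto
  have tW: "x w = t" if "w \<in> W" for w
    using pend[OF that] pend[OF w0] q1 by (metis mult_left_cancel t_def)
  have t: "0 < t"
    using pend[OF w0] hub_pos x(1)[of w0] unfolding t_def
    by (metis less_eq_real_def mult_zero_right less_irrefl)
  have q: "0 < ?q"
    using pend[OF w0] hub_pos t unfolding t_def by (smt (verit) mult_nonneg_nonneg mult_nonpos_nonneg)

  \<comment> \<open>Test vector on the extremal graph: a vertex in \<open>T\<close> absorbs one
    pendent vertex and keeps the larger value, and the \<open>M - c\<close> unabsorbed pendent
    vertices, at indices from \<open>c\<close> on, keep \<open>t\<close>.\<close>
  define z where "z = (\<lambda>i. if i < c then (if i \<in> T then max (x (p i)) t else x (p i)) else t)"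
  have z0: "z 0 = x (p 0)" using c by (auto simp: z_def T_def)
  have zS: "z i = x (p i)" if "i \<in> S" for i using that by (auto simp: z_def S_def T_def)
  have zT: "z i = max (x (p i)) t" if "i \<in> T" for i using that by (auto simp: z_def T_def)
  have zt: "z i = t" if "i \<in> {c..<M}" for i using that by (auto simp: z_def)
  have zge: "x (p i) \<le> z i" if "i < c" for i using that by (auto simp: z_def)
  have split: "(\<Sum>i=1..<M. g i) = (\<Sum>i\<in>S. g i) + (\<Sum>i\<in>T. g i) + (\<Sum>i=c..<M. g i)" for g :: "nat \<Rightarrow> real"
  proof -
    have "{1..<M} = {1..<c} \<union> {c..<M}" using c by (auto simp: M_def)
    then have "{1..<M} = S \<union> T \<union> {c..<M}" using ST(1) by simp
    moreover have "(S \<union> T) \<inter> {c..<M} = {}" by (auto simp: S_def T_def)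
    ultimately show ?thesis using ST by (simp add: sum.union_disjoint)
  qed
  have "(\<Sum>u\<in>N. (x (p 0) + x u)\<^sup>2) = (\<Sum>i\<in>S. (x (p 0) + x (p i))\<^sup>2) + (\<Sum>u\<in>W. (x (p 0) + x u)\<^sup>2)"
    unfolding NSW(1) using ST NSW(2) fW by (simp add: sum.union_disjoint sum.reindex[OF injS])
  also have "(\<Sum>u\<in>W. (x (p 0) + x u)\<^sup>2) = real (card W) * (x (p 0) + t)\<^sup>2" using tW by simp
  also have "\<dots> = real (card T) * (x (p 0) + t)\<^sup>2 + real (M - c) * (x (p 0) + t)\<^sup>2"
    by (simp add: cW distrib_right)
  \<comment> \<open>The pendent edges of the absorbed vertices become the missing edges to the
    vertices in \<open>T\<close>.\<close>
  also have "real (card T) * (x (p 0) + t)\<^sup>2 \<le> (\<Sum>i\<in>T. (z 0 + z i)\<^sup>2)"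
  proof -
    have "(\<Sum>i\<in>T. (x (p 0) + t)\<^sup>2) \<le> (\<Sum>i\<in>T. (z 0 + z i)\<^sup>2)"
      using z0 hub_pos t by (intro sum_mono power_mono) (auto simp: zT)
    then show ?thesis by simp
  qed
  finally have star: "(\<Sum>u\<in>N. (x (p 0) + x u)\<^sup>2) \<le> (\<Sum>i=1..<M. (z 0 + z i)\<^sup>2)"
    unfolding split by (simp add: z0 zS zt)
  have path: "(\<Sum>i=1..<c-1. (x (p i) + x (p (Suc i)))\<^sup>2) \<le> (\<Sum>i=1..<c-1. (z i + z (Suc i))\<^sup>2)"
    using zge x(1) by (intro sum_mono power_mono add_mono add_nonneg_nonneg) auto
  have "?q = qform ?E x"
    unfolding qform_eq_inner using x(2)
    by (simp add: x(3) power2_eq_square sum_distrib_left[symmetric] algebra_simps)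
  also have "\<dots> = (\<Sum>u\<in>N. (x (p 0) + x u)\<^sup>2) + (\<Sum>i=1..<c-1. (x (p i) + x (p (Suc i)))\<^sup>2)"
    using qform_hub_path[OF p(1) fN v, of x] E by (simp add: N_def)
  also have "\<dots> \<le> (\<Sum>i=1..<M. (z 0 + z i)\<^sup>2) + (\<Sum>i=1..<c-1. (z i + z (Suc i))\<^sup>2)"
    using star path by (rule add_mono)
  also have "\<dots> \<le> ?q' * (\<Sum>i=0..<M. (z i)\<^sup>2)"
    unfolding M_def by (rule extremal_graph_Rayleigh[OF c])
  finally have main: "?q \<le> ?q' * (\<Sum>i=0..<M. (z i)\<^sup>2)" .

  have "(\<Sum>i=0..<M. (z i)\<^sup>2) = (z 0)\<^sup>2 + (\<Sum>i=1..<M. (z i)\<^sup>2)"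
    using c by (simp add: sum.atLeast_Suc_lessThan M_def)
  also have "\<dots> = (x (p 0))\<^sup>2 + (\<Sum>i\<in>S. (x (p i))\<^sup>2) + (\<Sum>i\<in>T. (max (x (p i)) t)\<^sup>2) + real (M - c) * t\<^sup>2"
    unfolding split by (simp add: z0 zS zT zt)
  \<comment> \<open>Strict because both merged values are positive and only the square of the larger
    survives; \<open>T\<close> is nonempty since it contains \<open>j\<close>.\<close>
  also have "(\<Sum>i\<in>T. (max (x (p i)) t)\<^sup>2) < (\<Sum>i\<in>T. (x (p i))\<^sup>2 + t\<^sup>2)"
  proof (rule sum_strict_mono[OF ST(4)])
    show "T \<noteq> {}" using Tj by blast
    fix i assume "i \<in> T"
    then have "0 < x (p i)" using path_pos by (auto simp: T_def)
    then show "(max (x (p i)) t)\<^sup>2 < (x (p i))\<^sup>2 + t\<^sup>2" using t by (auto simp: max_def)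
  qed
  also have "(\<Sum>i\<in>T. (x (p i))\<^sup>2 + t\<^sup>2) = (\<Sum>i\<in>T. (x (p i))\<^sup>2) + real (card T) * t\<^sup>2"
    by (simp add: sum.distrib)
  finally have "(\<Sum>i=0..<M. (z i)\<^sup>2)
      < (x (p 0))\<^sup>2 + ((\<Sum>i\<in>S. (x (p i))\<^sup>2) + (\<Sum>i\<in>T. (x (p i))\<^sup>2)) + real (card W) * t\<^sup>2"
    by (simp add: cW algebra_simps)
  also have "(\<Sum>i\<in>S. (x (p i))\<^sup>2) + (\<Sum>i\<in>T. (x (p i))\<^sup>2) = (\<Sum>i=1..<c. (x (p i))\<^sup>2)"
    unfolding ST(1) using ST by (simp add: sum.union_disjoint)
  also have "(x (p 0))\<^sup>2 + (\<Sum>i=1..<c. (x (p i))\<^sup>2) = (\<Sum>i<c. (x (p i))\<^sup>2)"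
    using c by (simp add: sum.atLeast_Suc_lessThan lessThan_atLeast0)
  also have "\<dots> = (\<Sum>u\<in>p ` {..<c}. (x u)\<^sup>2)" by (simp add: sum.reindex[OF p(1)])
  also have "real (card W) * t\<^sup>2 = (\<Sum>u\<in>W. (x u)\<^sup>2)" using tW by simp
  also have "(\<Sum>u\<in>p ` {..<c}. (x u)\<^sup>2) + (\<Sum>u\<in>W. (x u)\<^sup>2) = (\<Sum>u\<in>?V. (x u)\<^sup>2)"
  proof -
    have "?V = p ` {..<c} \<union> W" using V by (auto simp: W_def)
    moreover have "p ` {..<c} \<inter> W = {}" by (auto simp: W_def)
    ultimately show ?thesis using fW by (simp add: sum.union_disjoint)
  qed
  finally have norm: "(\<Sum>i=0..<M. (z i)\<^sup>2) < 1" using x(2) by simp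
  \<comment> \<open>Positivity of \<open>?q'\<close> turns the strict loss in the norm into a strict
    gain in the radius.\<close>
  have "(\<Sum>i=0..<M. (z i)\<^sup>2) \<ge> 0" by (simp add: sum_nonneg)
  with main q have "0 < ?q'" by (smt (verit) mult_nonpos_nonneg)
  then have "?q' * (\<Sum>i=0..<M. (z i)\<^sup>2) < ?q' * 1" using norm by (rule mult_strict_left_mono[rotated])
  with main show ?thesis by linarith
qed

text \<open>With every path vertex joined to the hub, \<open>N\<close> consists of the path vertices
  and \<open>M - c\<close> pendent vertices. Any matching of the latter with \<open>{c..<M}\<close>
  extends \<open>p\<close> to an isomorphism from the extremal graph.\<close>

lemma graph_iso_extremal:
  assumes G: "simple_graph G" and ni: "no_isolated_vertices G"
    and p: "inj_on p {..<c}" "p ` {..<c} \<subseteq> verts G" and c: "3 \<le> c" "2 * c \<le> m + 3"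
    and E: "edges G = hub_path (nbrs (edges G) (p 0)) p c"
    and d: "card (nbrs (edges G) (p 0)) = m + 2 - c"
    and chords: "p ` {1..<c} \<subseteq> nbrs (edges G) (p 0)"
  shows "graph_iso G (extremal_graph m c)"
proof (rule graph_iso_sym)
  let ?V = "verts G" and ?E = "edges G"
  interpret fin_graph ?V ?E using G by (rule simple_graph_imp_fin_graph)
  define N where "N = nbrs ?E (p 0)"
  define M where "M = m + 3 - c"
  have fN: "finite N" and v: "p 0 \<notin> N" using finite_nbrs not_nbr_self by (auto simp: N_def)
  have V: "?V = p ` {..<c} \<union> N" unfolding N_def by (rule hub_path_vertices[OF G ni p(2) c(1) E])
  define W where "W = N - p ` {1..<c}"
  have "card (p ` {1..<c}) = c - 1"
    by (subst card_image) (auto intro: inj_on_subset[OF p(1)])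
  then have cW: "card W = M - c"
    unfolding W_def using chords d c by (subst card_Diff_subset) (auto simp: N_def M_def)
  have fW: "finite W" using fN by (simp add: W_def)
  have "card {c..<M} = card W" using cW by simp
  then obtain h where h: "bij_betw h {c..<M} W"
    using finite_same_card_bij[of "{c..<M}" W] fW by auto
  define g where "g = (\<lambda>i. if i < c then p i else h i)"
  have gp: "bij_betw g {..<c} (p ` {..<c})"
    using p(1) by (subst bij_betw_cong[of _ _ p]) (auto simp: g_def bij_betw_def)
  have gh: "bij_betw g {c..<M} W" using h by (subst bij_betw_cong[of _ _ h]) (auto simp: g_def)
  have zero: "{..<c} = insert 0 {1..<c}" using c by auto
  have disj: "p ` {..<c} \<inter> W = {}" unfolding zero using v by (auto simp: W_def)
  have NW: "N = g ` {1..<M}"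
  proof -
    have "{1..<M} = {1..<c} \<union> {c..<M}" using c by (auto simp: M_def)
    then have "g ` {1..<M} = g ` {1..<c} \<union> W" using gh by (simp add: image_Un bij_betw_def)
    also have "g ` {1..<c} = p ` {1..<c}" by (auto simp: g_def)
    finally show ?thesis using chords by (auto simp: W_def N_def)
  qed
  have "{0..<M} = {..<c} \<union> {c..<M}" using c by (auto simp: M_def)
  moreover have "?V = p ` {..<c} \<union> W" using V unfolding zero by (auto simp: W_def)
  ultimately have bij: "bij_betw g {0..<M} ?V"
    using bij_betw_combine[OF gp gh disj] by simp
  have inj: "inj_on g {0..<M}" using bij by (simp add: bij_betw_def)
  have img: "?E = (`) g ` edges (extremal_graph m c)"
  proof -
    have "(\<lambda>i. {p i, p (Suc i)}) ` {1..<c - 1} = (\<lambda>i. {g i, g (Suc i)}) ` {1..<c - 1}"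
      by (intro image_cong) (auto simp: g_def)
    moreover have "p 0 = g 0" using c by (simp add: g_def)
    ultimately have "hub_path N p c = (\<lambda>u. {g 0, u}) ` g ` {1..<M} \<union> (\<lambda>i. {g i, g (Suc i)}) ` {1..<c - 1}"
      by (simp add: hub_path_def NW)
    also have "\<dots> = (`) g ` edges (extremal_graph m c)"
      unfolding edges_extremal_graph[OF c] M_def hub_path_def by (simp add: image_Un image_image)
    finally show ?thesis using E by (simp add: N_def)
  qed
  have sub: "e \<subseteq> {0..<M}" if "e \<in> edges (extremal_graph m c)" for e
    using that simple_graph_extremal[OF c] verts_extremal_graph[OF c(2)]
    by (simp add: simple_graph_def M_def)
  have "{u, w} \<in> edges (extremal_graph m c) \<longleftrightarrow> {g u, g w} \<in> ?E"
    if uw: "u \<in> {0..<M}" "w \<in> {0..<M}" for u w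
  proof
    assume "{u, w} \<in> edges (extremal_graph m c)"
    then have "g ` {u, w} \<in> ?E" unfolding img by (rule imageI)
    then show "{g u, g w} \<in> ?E" by simp
  next
    assume "{g u, g w} \<in> ?E"
    then obtain e where e: "e \<in> edges (extremal_graph m c)" "g ` {u, w} = g ` e"
      unfolding img by auto
    then have "{u, w} = e"
      using inj_on_image_eq_iff[OF inj, of "{u, w}" e] sub[OF e(1)] uw by simp
    then show "{u, w} \<in> edges (extremal_graph m c)" using e(1) by simp
  qed
  then show "graph_iso (extremal_graph m c) G"
    unfolding graph_iso_def verts_extremal_graph[OF c(2)] M_def[symmetric] using bij by blast
qed

theorem theorem1p2:
  fixes m c :: nat and H :: "'a ugraph"
  assumes "c \<ge> 3" and "m \<ge> 3 * c - 4" and "H \<in> graphs_with m c"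
  shows "signless_Laplacian_radius H \<le> signless_Laplacian_radius (extremal_graph m c) \<and>
    (signless_Laplacian_radius H = signless_Laplacian_radius (extremal_graph m c)
       \<longleftrightarrow> graph_iso H (extremal_graph m c))"
proof -
  have G: "simple_graph H" and ni: "no_isolated_vertices H" and m: "card (edges H) = m"
    and circ: "circumference H = c"
    using assms(3) by (auto simp: graphs_with_def)
  interpret fin_graph "verts H" "edges H" using G by (rule simple_graph_imp_fin_graph)
  have c: "3 \<le> c" "2 * c \<le> m + 3" using assms by auto
  let ?q = "signless_Laplacian_radius H" and ?q' = "signless_Laplacian_radius (extremal_graph m c)"
    and ?d = "\<lambda>v. card (nbrs (edges H) v)"
  have iso: "graph_iso H (extremal_graph m c) \<Longrightarrow> ?q = ?q'"
    by (rule signless_Laplacian_radius_iso[OF G simple_graph_extremal[OF c]])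
  have "edges H \<noteq> {}" using m assms by auto
  then have ne: "verts H \<noteq> {}" using edgeE by blast
  \<comment> \<open>The case split is on whether some vertex has degree at least
    \<open>m - c + 2\<close>.\<close>
  have "?q < ?q' \<or> graph_iso H (extremal_graph m c)"
  proof (cases "\<exists>v\<in>verts H. m \<le> ?d v + (c - 2)")
    case True
    then obtain v where v: "m \<le> ?d v + (c - 2)" by blast
    obtain p where p: "p 0 = v" "inj_on p {..<c}" "p ` {..<c} \<subseteq> verts H"
      "edges H = hub_path (nbrs (edges H) v) p c"
      "\<And>i. Suc i < c \<Longrightarrow> {p i, p (Suc i)} \<in> edges H" "card (edges H) = ?d v + (c - 2)"
      using hub_structure[OF G circ c(1), of v] v m by metis
    have d: "?d (p 0) = m + 2 - c" using p(1,6) m c by simp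
    have E: "edges H = hub_path (nbrs (edges H) (p 0)) p c" using p(1,4) by simp
    show ?thesis
    proof (cases "p ` {1..<c} \<subseteq> nbrs (edges H) (p 0)")
      case True
      then show ?thesis using graph_iso_extremal[OF G ni p(2,3) c E d] by blast
    next
      case False
      then obtain j where "j \<in> {1..<c}" "p j \<notin> nbrs (edges H) (p 0)" by blast
      then show ?thesis using radius_less_of_missing_chord[OF G ni p(2,3) c E p(5) d] by blast
    qed
  next
    case False
    then have D: "?d v + c \<le> m + 1" if "v \<in> verts H" for v using that c by fastforce
    \<comment> \<open>This threshold lies strictly below the radius of the extremal graph.\<close>
    have "?q \<le> real (m + 3 - c)"
    proof (cases "c = 3 \<and> m = 5")
      case True
      then have "?q \<le> 5" using D circ m by (intro radius_le_5[OF G ni ne]) force+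
      then show ?thesis using True by simp
    next
      case small: False
      show ?thesis
      proof (cases "\<exists>v\<in>verts H. ?d v + c = m + 1")
        case True
        then obtain v where v: "v \<in> verts H" "?d v + c = m + 1" by blast
        \<comment> \<open>With \<open>e = c - 1\<close> edges avoiding \<open>v\<close>, the
          condition \<open>2 * e \<le> ?d v + 1\<close> is exactly \<open>m \<ge> 3 * c - 4\<close>.
          The other one is \<open>2 * c \<le> m\<close>, which under this bound fails only for
          \<open>c = 3\<close>, \<open>m = 5\<close>.\<close>
        have "?q \<le> real (?d v + 2)"
          by (rule radius_le_hub_degree_plus_2[OF G ni v(1) refl, of "c - 1"])
            (use v m assms small in linarith)+
        then show ?thesis using v c by (simp add: of_nat_diff)
      next
        case False
        \<comment> \<open>For \<open>D = m - c\<close> the edge bound \<open>m \<le> 2 * D\<close>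
          is again \<open>2 * c \<le> m\<close>.\<close>
        then have "?d v \<le> m - c" if "v \<in> verts H" for v using D[OF that] that by fastforce
        then have "?q \<le> real (m - c + 3)"
          using m assms small by (intro radius_le_max_degree_plus_3[OF G ni ne]) auto
        then show ?thesis using c by (simp add: of_nat_diff)
      qed
    qed
    then show ?thesis using extremal_graph_radius_gt[OF c] by linarith
  qed
  then show ?thesis using iso by fastforce
qed

end
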